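(* Let $\lambda_0,\lambda_1>0$ satisfy $e^{-\lambda_0}+e^{-\lambda_1}\le 1$, and let $L=\pi(A)$ and $L_\alpha=\pi(A_\alpha)$ ($\alpha\in[0,1]$) be the subsets of $[0,1]$ defined in the context. Then $$\dim_H L=\dim_H L_0=-\frac{\log(1-p)}{\lambda_0},$$ where $p\in[0,1]$ is the unique solution of the equation $$p^{2\lambda_0}=(1-p)^{2\lambda_1+\lambda_0}.$$ For any $\alpha\in(0,1]$, $$\dim_H L_\alpha=\frac{\alpha\log\frac{p(1-q)}{(1-p)q}-2\log(1-p)}{2\lambda_0},$$ where $(p,q)\in[0,1]^2$ is the unique solution of the system $$\begin{cases}\alpha(\lambda_1-\lambda_0)\log\dfrac{p(1-q)}{(1-p)q}+\lambda_0\log\dfrac{p^2(1-q)}{1-p}-2\lambda_1\log(1-p)=0,\\[2mm] 2pq=\alpha(2+p-q).\end{cases}$$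
   Context: $\mathbb N=\{1,2,3,\dots\}$, $\Sigma=\{0,1\}^{\mathbb N}$, $\log$ is the natural logarithm, and $\dim_H$ denotes Hausdorff dimension of subsets of $\mathbb R$. Iterated function system: $f_0(x)=e^{-\lambda_0}x$ and $f_1(x)=e^{-\lambda_1}x+1-e^{-\lambda_1}$ on $[0,1]$. The natural projection $\pi:\Sigma\to[0,1]$ is $\pi(\omega)=\lim_{n\to\infty}f_{\omega_1}\circ f_{\omega_2}\circ\cdots\circ f_{\omega_n}(0)$. $A=\{\omega\in\Sigma:\ \omega_k\omega_{2k}=0\text{ for all }k\ge1\}$, and for $\alpha\in[0,1]$, $A_\alpha=\{\omega\in\Sigma:\ \lim_{n\to\infty}\frac1n\sum_{k=1}^n\omega_k\omega_{2k}=\alpha\}$. $L=\pi(A)$, $L_\alpha=\pi(A_\alpha)$.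
   Formalization: At α=1 the second equation forces p=q=1, where the first equation and the dimension formula contain log(0/0); there the formal theorem states instead that, as α→1⁻, the solutions (p,q) tend to (1,1) and the formula tends to dim_H L_1. *)

theory Defs
  imports "HOL-Analysis.Analysis"
begin

text \<open>The \<open>s\<close>-dimensional size \<open>diam(U)\<^sup>s\<close> of a covering set, with the usual conventions that the
  empty set contributes 0 and that \<open>diam(U)\<^sup>0 = 1\<close> for \<open>U\<close> nonempty (whereas \<open>0 powr 0 = 0\<close>).\<close>

definition diam_power :: "real \<Rightarrow> real set \<Rightarrow> ennreal" where
  "diam_power s U =
     (if U = {} then 0 else if s = 0 then 1 else ennreal (diameter U powr s))"

text \<open>Boundedness of the covering sets is required because the library's \<open>diameter\<close> is only
  meaningful for bounded sets.\<close>

definition hausdorff_content :: "real \<Rightarrow> real \<Rightarrow> real set \<Rightarrow> ennreal" where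
  "hausdorff_content s \<delta> E =
     (INF U \<in> {U :: nat \<Rightarrow> real set. E \<subseteq> (\<Union>i. U i) \<and> (\<forall>i. bounded (U i) \<and> diameter (U i) \<le> \<delta>)}.
        (\<Sum>i. diam_power s (U i)))"

definition hausdorff_measure :: "real \<Rightarrow> real set \<Rightarrow> ennreal" where
  "hausdorff_measure s E = (SUP \<delta> \<in> {0<..}. hausdorff_content s \<delta> E)"

text \<open>For subsets of the line the set below contains every \<open>s > 1\<close>, so the real infimum is the
  Hausdorff dimension.\<close>

definition hausdorff_dim :: "real set \<Rightarrow> real" where
  "hausdorff_dim E = Inf {s. 0 \<le> s \<and> hausdorff_measure s E = 0}"

text \<open>\<open>{0,1}\<^sup>\<nat>\<close> with \<open>\<nat> = {1,2,\<dots>}\<close>; the coordinate 0 carries no information.\<close>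

definition binary_seqs :: "(nat \<Rightarrow> nat) set" where
  "binary_seqs = {1..} \<rightarrow>\<^sub>E {0, 1}"

definition ifs :: "real \<Rightarrow> real \<Rightarrow> nat \<Rightarrow> real \<Rightarrow> real" where
  "ifs l\<^sub>0 l\<^sub>1 i x =
     (if i = 0 then exp (- l\<^sub>0) * x else exp (- l\<^sub>1) * x + 1 - exp (- l\<^sub>1))"

primrec ifs_comp :: "real \<Rightarrow> real \<Rightarrow> (nat \<Rightarrow> nat) \<Rightarrow> nat \<Rightarrow> real \<Rightarrow> real" where
  "ifs_comp l\<^sub>0 l\<^sub>1 \<omega> 0 = id"
| "ifs_comp l\<^sub>0 l\<^sub>1 \<omega> (Suc n) = ifs_comp l\<^sub>0 l\<^sub>1 \<omega> n \<circ> ifs l\<^sub>0 l\<^sub>1 (\<omega> (Suc n))"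

definition natural_proj :: "real \<Rightarrow> real \<Rightarrow> (nat \<Rightarrow> nat) \<Rightarrow> real" where
  "natural_proj l\<^sub>0 l\<^sub>1 \<omega> = lim (\<lambda>n. ifs_comp l\<^sub>0 l\<^sub>1 \<omega> n 0)"

definition A_set :: "(nat \<Rightarrow> nat) set" where
  "A_set = {\<omega> \<in> binary_seqs. \<forall>k\<ge>1. \<omega> k * \<omega> (2 * k) = 0}"

definition A_level :: "real \<Rightarrow> (nat \<Rightarrow> nat) set" where
  "A_level \<alpha> = {\<omega> \<in> binary_seqs.
     (\<lambda>n. 1 / real n * (\<Sum>k = 1..n. real (\<omega> k * \<omega> (2 * k)))) \<longlonglongrightarrow> \<alpha>}"

definition L_set :: "real \<Rightarrow> real \<Rightarrow> real set" where
  "L_set l\<^sub>0 l\<^sub>1 = natural_proj l\<^sub>0 l\<^sub>1 ` A_set"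

definition L_level :: "real \<Rightarrow> real \<Rightarrow> real \<Rightarrow> real set" where
  "L_level l\<^sub>0 l\<^sub>1 \<alpha> = natural_proj l\<^sub>0 l\<^sub>1 ` A_level \<alpha>"

text \<open>The pair \<open>(p, q)\<close> in the unit square solves the system. Since \<open>ln 0 = 0\<close> and \<open>x / 0 = 0\<close> in
  HOL, it is demanded explicitly that every logarithm has a well-defined positive argument;
  otherwise \<open>p = 1\<close> would give a spurious solution of the first equation.

  At \<open>\<alpha> = 1\<close> the second equation forces \<open>p = q = 1\<close>, where the first equation and the dimension formula
  contain \<open>log (0/0)\<close>. No pair solves the system in the present sense; the theorem treats \<open>\<alpha> = 1\<close> as the
  limit \<open>\<alpha> \<rightarrow> 1-\<close> of the solutions and of the formula.\<close>

definition solves_system :: "real \<Rightarrow> real \<Rightarrow> real \<Rightarrow> real \<Rightarrow> real \<Rightarrow> bool" where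
  "solves_system l\<^sub>0 l\<^sub>1 \<alpha> p q \<longleftrightarrow>
     p \<in> {0..1} \<and> q \<in> {0..1} \<and>
     (1 - p) * q \<noteq> 0 \<and> 0 < p * (1 - q) / ((1 - p) * q) \<and>
     0 < p\<^sup>2 * (1 - q) / (1 - p) \<and> 0 < 1 - p \<and>
     \<alpha> * (l\<^sub>1 - l\<^sub>0) * ln (p * (1 - q) / ((1 - p) * q))
       + l\<^sub>0 * ln (p\<^sup>2 * (1 - q) / (1 - p)) - 2 * l\<^sub>1 * ln (1 - p) = 0 \<and>
     2 * p * q = \<alpha> * (2 + p - q)"

definition dim_formula :: "real \<Rightarrow> real \<Rightarrow> real \<Rightarrow> real \<Rightarrow> real" where
  "dim_formula l\<^sub>0 \<alpha> p q =
     (\<alpha> * ln (p * (1 - q) / ((1 - p) * q)) - 2 * ln (1 - p)) / (2 * l\<^sub>0)"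

end

theory Submission
  imports Defs "HOL-Real_Asymp.Real_Asymp"
begin

text \<open>A sequence splits into the chains \<open>(\<omega>\<^sub>k, \<omega>\<^sub>2\<^sub>k, \<omega>\<^sub>4\<^sub>k, \<dots>)\<close> with \<open>k\<close> odd. Let all chains be
  independent Markov chains with transition probabilities \<open>P(0,1) = p\<close>, \<open>P(1,1) = q\<close> and initial law
  \<open>P(0,\<cdot>)\<close>. The first equation of the system says precisely that the logarithm of the mass of the
  \<open>n\<close>-th cylinder is, for every \<open>\<omega>\<close>,
  \<open>s * ln |I\<^sub>n| + \<beta> * (N\<^sub>n - \<alpha> * n / 2) + \<kappa> * (S\<^sub>n - 2 * S\<^bsub>n div 2\<^esub>)\<close>,
  where \<open>s\<close> is the claimed dimension, \<open>|I\<^sub>n|\<close> the length of the basic interval, \<open>N\<^sub>n\<close> the sum of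
  \<open>\<omega>\<^sub>k * \<omega>\<^sub>2\<^sub>k\<close> over \<open>2 * k \<le> n\<close> and \<open>S\<^sub>n\<close> the number of ones up to \<open>n\<close>.
  On the level set the middle term is \<open>o(n)\<close>, and since \<open>S\<^sub>n / n\<close> is bounded, the last one exceeds
  \<open>- \<epsilon> * n\<close> for infinitely many \<open>n = 2\<^sup>j\<close>; this gives the upper bound. The second equation says that
  the level set is typical for the chain, and typically \<open>S\<^sub>n / n\<close> converges, so the last term is also
  \<open>o(n)\<close>; this gives the lower bound by mass distribution. Masses are only ever assigned to finite
  words: exponential martingale bounds control the atypical words, and Koenig's lemma replaces countable
  additivity. The cases \<open>\<alpha> = 0\<close> and \<open>\<alpha> = 1\<close> are limits, because the upper bound needs the first
  equation only.\<close>

section \<open>Hausdorff measure and dimension\<close>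

lemma hausdorff_measure_eq_0I:
  assumes "\<And>\<delta> e. \<delta> > 0 \<Longrightarrow> e > 0 \<Longrightarrow> \<exists>U :: nat \<Rightarrow> real set. E \<subseteq> (\<Union>i. U i) \<and>
             (\<forall>i. bounded (U i) \<and> diameter (U i) \<le> \<delta>) \<and> (\<Sum>i. diam_power s (U i)) \<le> ennreal e"
  shows "hausdorff_measure s E = 0"
proof -
  have "hausdorff_content s \<delta> E \<le> 0" if "\<delta> > 0" for \<delta>
  proof (rule ennreal_le_epsilon)
    fix e :: real assume "e > 0"
    then obtain U where U: "E \<subseteq> (\<Union>i. U i)" "\<forall>i. bounded (U i) \<and> diameter (U i) \<le> \<delta>"
      "(\<Sum>i. diam_power s (U i)) \<le> ennreal e"
      using assms \<open>\<delta> > 0\<close> by meson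
    have "hausdorff_content s \<delta> E \<le> (\<Sum>i. diam_power s (U i))"
      unfolding hausdorff_content_def by (rule INF_lower) (use U in auto)
    then show "hausdorff_content s \<delta> E \<le> 0 + ennreal e"
      using U by simp
  qed
  then show ?thesis
    unfolding hausdorff_measure_def by (simp add: SUP_eq_iff[of _ 0, simplified])
qed

lemma hausdorff_measure_eq_0D:
  assumes "hausdorff_measure s E = 0" "\<delta> > 0" "e > 0"
  obtains U :: "nat \<Rightarrow> real set" where "E \<subseteq> (\<Union>i. U i)" "\<And>i. bounded (U i)"
    "\<And>i. diameter (U i) \<le> \<delta>" "(\<Sum>i. diam_power s (U i)) < ennreal e"
proof -
  have "hausdorff_content s \<delta> E \<le> hausdorff_measure s E"
    unfolding hausdorff_measure_def by (rule SUP_upper) (use assms in auto)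
  then have "hausdorff_content s \<delta> E < ennreal e"
    using assms by simp
  then show thesis
    unfolding hausdorff_content_def INF_less_iff using that by blast
qed

lemma hausdorff_measure_mono:
  assumes "E \<subseteq> F"
  shows "hausdorff_measure s E \<le> hausdorff_measure s F"
  unfolding hausdorff_measure_def hausdorff_content_def
  using assms by (intro SUP_mono' INF_superset_mono) auto

lemma hausdorff_dim_bounds:
  assumes "0 \<le> s" "\<And>t. t > s \<Longrightarrow> hausdorff_measure t E = 0"
  shows "hausdorff_dim E \<in> {0..s}"
proof -
  let ?S = "{t. 0 \<le> t \<and> hausdorff_measure t E = 0}"
  have mem: "t \<in> ?S" if "t > s" for t
    using that assms by simp
  have "bdd_below ?S"
    by (rule bdd_belowI[of _ 0]) simp
  then have "Inf ?S \<le> t" if "t > s" for t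
    using mem[OF that] by (rule cInf_lower[rotated])
  then have "Inf ?S \<le> s"
    by (rule dense_ge)
  moreover have "0 \<le> Inf ?S"
    using mem[of "s + 1"] by (intro cInf_greatest) auto
  ultimately show ?thesis
    by (simp add: hausdorff_dim_def)
qed

lemma hausdorff_dim_eqI:
  assumes "0 \<le> s" "\<And>t. t > s \<Longrightarrow> hausdorff_measure t E = 0"
    and "\<And>t. 0 \<le> t \<Longrightarrow> t < s \<Longrightarrow> hausdorff_measure t E \<noteq> 0"
  shows "hausdorff_dim E = s"
proof (rule antisym)
  show "hausdorff_dim E \<le> s"
    using hausdorff_dim_bounds[OF assms(1,2)] by simp
  have "s + 1 \<in> {t. 0 \<le> t \<and> hausdorff_measure t E = 0}"
    using assms(1) assms(2)[of "s + 1"] by simp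
  moreover have "s \<le> t" if "t \<in> {t. 0 \<le> t \<and> hausdorff_measure t E = 0}" for t
    using that assms(3)[of t] by (auto simp: not_less[symmetric])
  ultimately show "s \<le> hausdorff_dim E"
    unfolding hausdorff_dim_def by (intro cInf_greatest) blast+
qed

lemma diam_power_empty [simp]: "diam_power s {} = 0"
  by (simp add: diam_power_def)

text \<open>Points are covered infinitely often, so the covers of levels n \<ge> N alone still cover
  \<open>E\<close>, and their total size is at most a tail of the convergent series
  \<open>c\<close>.\<close>

lemma hausdorff_measure_cantelli:
  fixes V :: "nat \<Rightarrow> 'b set" and I :: "nat \<Rightarrow> 'b \<Rightarrow> real set" and c d :: "nat \<Rightarrow> real"
  assumes fin: "\<And>n. finite (V n)"
    and bdd: "\<And>n v. v \<in> V n \<Longrightarrow> bounded (I n v)"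
    and diam: "\<And>n v. v \<in> V n \<Longrightarrow> diameter (I n v) \<le> d n" and "d \<longlonglongrightarrow> 0"
    and sum: "\<And>n. (\<Sum>v\<in>V n. diam_power s (I n v)) \<le> ennreal (c n)"
    and c: "summable c" "\<And>n. 0 \<le> c n"
    and cover: "\<And>x N. x \<in> E \<Longrightarrow> \<exists>n\<ge>N. \<exists>v\<in>V n. x \<in> I n v"
  shows "hausdorff_measure s E = 0"
proof (rule hausdorff_measure_eq_0I)
  fix \<delta> e :: real assume "\<delta> > 0" "e > 0"
  have "\<forall>\<^sub>F n in sequentially. d n < \<delta>"
    using \<open>d \<longlonglongrightarrow> 0\<close> \<open>\<delta> > 0\<close> by (rule order_tendstoD)
  moreover have "(\<lambda>n. suminf (\<lambda>i. c (i + n))) \<longlonglongrightarrow> 0"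
    using suminf_exist_split2[OF c(1)] by simp
  then have "\<forall>\<^sub>F n in sequentially. suminf (\<lambda>i. c (i + n)) < e"
    using \<open>e > 0\<close> by (rule order_tendstoD)
  ultimately have "\<forall>\<^sub>F n in sequentially. d n < \<delta> \<and> suminf (\<lambda>i. c (i + n)) < e"
    by eventually_elim auto
  then obtain N where N: "\<And>n. n \<ge> N \<Longrightarrow> d n < \<delta>" "suminf (\<lambda>i. c (i + N)) < e"
    unfolding eventually_sequentially by auto
  have "\<forall>n. \<exists>h. bij_betw h {0..<card (V n)} (V n)"
    using ex_bij_betw_nat_finite fin by blast
  then obtain h where h: "\<And>n. bij_betw (h n) {0..<card (V n)} (V n)"
    by metis
  \<comment> \<open>Each row lists the cover of one level and is padded with empty sets, which
    contribute 0; \<open>prod_decode\<close> then flattens the rows into one sequence.\<close>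
  define J where "J = (\<lambda>(n, j). if j < card (V (n + N)) then I (n + N) (h (n + N) j) else {})"
  have h_in: "h n j \<in> V n" if "j < card (V n)" for n j
    using h[of n] that by (auto simp: bij_betw_def)
  have row: "(\<Sum>j. diam_power s (J (n, j))) = (\<Sum>v\<in>V (n + N). diam_power s (I (n + N) v))" for n
  proof -
    have "(\<Sum>j. diam_power s (J (n, j))) = (\<Sum>j\<in>{0..<card (V (n + N))}. diam_power s (J (n, j)))"
      by (rule suminf_finite) (auto simp: J_def)
    also have "\<dots> = (\<Sum>j\<in>{0..<card (V (n + N))}. diam_power s (I (n + N) (h (n + N) j)))"
      by (rule sum.cong) (auto simp: J_def)
    also have "\<dots> = (\<Sum>v\<in>V (n + N). diam_power s (I (n + N) v))"
      using h by (rule sum.reindex_bij_betw)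
    finally show ?thesis .
  qed
  show "\<exists>U :: nat \<Rightarrow> real set. E \<subseteq> (\<Union>i. U i) \<and>
     (\<forall>i. bounded (U i) \<and> diameter (U i) \<le> \<delta>) \<and> (\<Sum>i. diam_power s (U i)) \<le> ennreal e"
  proof (intro exI conjI allI subsetI)
    fix x assume "x \<in> E"
    then obtain n v where "n \<ge> N" "v \<in> V n" "x \<in> I n v"
      using cover by blast
    moreover from this h obtain j where "j < card (V n)" "v = h n j"
      by (metis atLeastLessThan_iff bij_betw_iff_bijections)
    ultimately have "x \<in> J (prod_decode (prod_encode (n - N, j)))"
      by (simp add: J_def)
    then show "x \<in> (\<Union>i. J (prod_decode i))"
      by blast
  next
    fix i
    obtain n j where nj: "prod_decode i = (n, j)" by force
    show "bounded (J (prod_decode i))"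
      using bdd h_in by (auto simp: nj J_def)
    show "diameter (J (prod_decode i)) \<le> \<delta>"
      using diam[OF h_in] N(1)[of "n + N"] \<open>\<delta> > 0\<close> by (fastforce simp: nj J_def)
  next
    have "(\<Sum>i. diam_power s (J (prod_decode i))) = (\<Sum>n. \<Sum>v\<in>V (n + N). diam_power s (I (n + N) v))"
      using suminf_ennreal_2dimen[of "\<lambda>n. \<Sum>v\<in>V (n + N). diam_power s (I (n + N) v)"
          "\<lambda>p. diam_power s (J p)"] row by (simp add: comp_def)
    also have "\<dots> \<le> (\<Sum>n. ennreal (c (n + N)))"
      by (intro suminf_le sum) auto
    also have "\<dots> = ennreal (\<Sum>n. c (n + N))"
      using c by (intro suminf_ennreal2) (auto simp: summable_iff_shift)
    also have "\<dots> \<le> ennreal e"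
      using N by (intro ennreal_leI) auto
    finally show "(\<Sum>i. diam_power s (J (prod_decode i))) \<le> ennreal e" .
  qed
qed

text \<open>Stopping words at the scale of a covering set requires a positive scale, but the set may
  have diameter 0. A positive radius is substituted at the cost of an additive error
  \<open>e\<close>.\<close>

lemma diam_power_radius:
  fixes U :: "real set"
  assumes "bounded U" "diameter U \<le> \<delta>" "0 < \<delta>" "0 \<le> s" "0 < e" "U \<noteq> {}"
  obtains r where "0 < r" "r \<le> \<delta>" "diameter U \<le> r" "ennreal (r powr s) \<le> diam_power s U + ennreal e"
proof -
  consider "s = 0" | "s > 0" "diameter U > 0" | "s > 0" "diameter U = 0"
    using assms diameter_ge_0[of U] by fastforce
  then show thesis
  proof cases
    case 1
    then show ?thesis
      using that[of \<delta>] assms by (simp add: diam_power_def)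
  next
    case 2
    then show ?thesis
      using that[of "diameter U"] assms by (simp add: diam_power_def)
  next
    case 3
    \<comment> \<open>The second bound makes \<open>r powr s\<close> at most \<open>e\<close>, which
      pays for a set of diameter 0.\<close>
    define r where "r = min \<delta> (e powr (1 / s))"
    have "r powr s \<le> (e powr (1 / s)) powr s"
      using assms 3 by (intro powr_mono2) (auto simp: r_def)
    also have "\<dots> = e"
      using assms 3 by (simp add: powr_powr)
    finally have "ennreal (r powr s) \<le> ennreal e"
      by (rule ennreal_leI)
    then show ?thesis
      using that[of r] assms 3 by (auto simp: r_def diam_power_def)
  qed
qed

section \<open>Markov weights on finite words\<close>

definition words :: "nat \<Rightarrow> (nat \<Rightarrow> nat) set" where
  "words n = {1..n} \<rightarrow>\<^sub>E {0, 1}"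

text \<open>Odd indices start a new chain \<open>k, 2k, 4k, \<dots>\<close>; giving them a fictitious parent in state 0
  works because the chains start with the transition law of state 0.\<close>

definition parent :: "(nat \<Rightarrow> nat) \<Rightarrow> nat \<Rightarrow> nat" where
  "parent \<omega> k = (if even k then \<omega> (k div 2) else 0)"

definition tr :: "real \<Rightarrow> real \<Rightarrow> nat \<Rightarrow> nat \<Rightarrow> real" where
  "tr p q a b = (let r = (if a = 0 then p else q) in if b = 0 then 1 - r else r)"

definition mass :: "real \<Rightarrow> real \<Rightarrow> (nat \<Rightarrow> nat) \<Rightarrow> nat \<Rightarrow> real" where
  "mass p q \<omega> n = (\<Prod>k=1..n. tr p q (parent \<omega> k) (\<omega> k))"

definition ones :: "(nat \<Rightarrow> nat) \<Rightarrow> nat \<Rightarrow> real" where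
  "ones \<omega> n = (\<Sum>k=1..n. real (\<omega> k))"

definition pairs :: "(nat \<Rightarrow> nat) \<Rightarrow> nat \<Rightarrow> real" where
  "pairs \<omega> n = (\<Sum>k=1..n. real (parent \<omega> k * \<omega> k))"

text \<open>Each letter is centred at its conditional mean given the parent, and the weight
  \<open>c\<close> depends only on the parent, which has a smaller index. Under the weights
  \<open>mass\<close> this is a martingale in \<open>n\<close>.\<close>

definition mart :: "real \<Rightarrow> real \<Rightarrow> (nat \<Rightarrow> real) \<Rightarrow> (nat \<Rightarrow> nat) \<Rightarrow> nat \<Rightarrow> real" where
  "mart p q c \<omega> n = (\<Sum>k=1..n. c (parent \<omega> k) * (real (\<omega> k) - tr p q (parent \<omega> k) 1))"

section \<open>Finite words and consistency of the Markov weights\<close>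

lemma finite_words [simp, intro]: "finite (words n)"
  unfolding words_def by (intro finite_PiE) auto

lemma words_0: "words 0 = {\<lambda>_. undefined}"
  by (simp add: words_def)

lemma words_Suc: "words (Suc n) = (\<lambda>(b, u). u(Suc n := b)) ` ({0, 1} \<times> words n)"
  unfolding words_def by (simp add: atLeastAtMostSuc_conv PiE_insert_eq)

lemma fun_upd_Suc_inj:
  assumes "u \<in> words n" "v \<in> words n" "u(Suc n := a) = v(Suc n := b)"
  shows "u = v"
proof
  fix k show "u k = v k"
  proof (cases "k = Suc n")
    case True
    then show ?thesis
      using assms by (auto simp: words_def PiE_def extensional_def)
  next
    case False
    then show ?thesis
      using fun_cong[OF assms(3), of k] by simp
  qed
qed

lemma sum_words_Suc:
  fixes g :: "(nat \<Rightarrow> nat) \<Rightarrow> 'a :: comm_monoid_add"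
  shows "(\<Sum>u\<in>words (Suc n). g u) = (\<Sum>u\<in>words n. g (u(Suc n := 0)) + g (u(Suc n := 1)))"
proof -
  have "inj_on (\<lambda>(b, u). u(Suc n := b)) ({0, 1 :: nat} \<times> words n)"
  proof (rule inj_onI, clarify)
    fix a b :: nat and u v
    assume *: "u \<in> words n" "v \<in> words n" "u(Suc n := a) = v(Suc n := b)"
    show "a = b \<and> u = v"
      using fun_upd_Suc_inj[OF *] fun_cong[OF *(3), of "Suc n"] by simp
  qed
  then have "(\<Sum>u\<in>words (Suc n). g u) = (\<Sum>x\<in>{0, 1} \<times> words n. g ((\<lambda>(b, u). u(Suc n := b)) x))"
    unfolding words_Suc by (subst sum.reindex) (auto simp: comp_def)
  also have "\<dots> = (\<Sum>b\<in>{0, 1}. \<Sum>u\<in>words n. g (u(Suc n := b)))"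
    by (simp add: sum.cartesian_product split_def)
  finally show ?thesis
    by (simp add: sum.distrib)
qed

lemma words_cases: "u \<in> words n \<Longrightarrow> 1 \<le> k \<Longrightarrow> k \<le> n \<Longrightarrow> u k = 0 \<or> u k = 1"
  by (auto simp: words_def PiE_def Pi_def)

lemma binary_cases: "\<omega> \<in> binary_seqs \<Longrightarrow> 1 \<le> k \<Longrightarrow> \<omega> k = 0 \<or> \<omega> k = 1"
  by (auto simp: binary_seqs_def PiE_def Pi_def)

lemma restrict_words:
  assumes "u \<in> words m" "n \<le> m"
  shows "restrict u {1..n} \<in> words n"
  using assms by (auto simp: words_def PiE_def Pi_def)

lemma restrict_binary: "\<omega> \<in> binary_seqs \<Longrightarrow> restrict \<omega> {1..n} \<in> words n"
  by (auto simp: words_def binary_seqs_def PiE_def Pi_def)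

lemma restrict_self: "u \<in> words n \<Longrightarrow> restrict u {1..n} = u"
  by (auto simp: words_def PiE_def extensional_restrict)

lemma parent_cong:
  "(\<And>k. 1 \<le> k \<Longrightarrow> k \<le> n \<Longrightarrow> u k = v k) \<Longrightarrow> 1 \<le> k \<Longrightarrow> k \<le> n \<Longrightarrow> parent u k = parent v k"
  by (auto simp: parent_def elim!: evenE)

lemma parent_le_1:
  assumes "\<And>k. 1 \<le> k \<Longrightarrow> k \<le> n \<Longrightarrow> u k = 0 \<or> u k = 1" "1 \<le> k" "k \<le> Suc n"
  shows "parent u k = 0 \<or> parent u k = 1"
proof (cases "even k")
  case True
  then have "1 \<le> k div 2 \<and> k div 2 \<le> n"
    using assms by (auto elim!: evenE)
  then show ?thesis
    using assms(1)[of "k div 2"] by (auto simp: parent_def)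
qed (auto simp: parent_def)

lemma parent_upd:
  assumes "1 \<le> k" "k \<le> Suc n"
  shows "parent (u(Suc n := b)) k = parent u k"
  using assms by (auto simp: parent_def)

lemma mass_cong: "(\<And>k. 1 \<le> k \<Longrightarrow> k \<le> n \<Longrightarrow> u k = v k) \<Longrightarrow> mass p q u n = mass p q v n"
  unfolding mass_def using parent_cong[of n u v] by (intro prod.cong refl) simp

lemma mart_cong: "(\<And>k. 1 \<le> k \<Longrightarrow> k \<le> n \<Longrightarrow> u k = v k) \<Longrightarrow> mart p q c u n = mart p q c v n"
  unfolding mart_def using parent_cong[of n u v] by (intro sum.cong refl) simp

lemma mass_upd: "mass p q (u(Suc n := b)) (Suc n) = mass p q u n * tr p q (parent u (Suc n)) b"
proof -
  have "mass p q (u(Suc n := b)) n = mass p q u n"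
    by (rule mass_cong) auto
  then show ?thesis
    by (simp add: mass_def parent_upd)
qed

lemma mart_upd:
  "mart p q c (u(Suc n := b)) (Suc n) =
     mart p q c u n + c (parent u (Suc n)) * (real b - tr p q (parent u (Suc n)) 1)"
proof -
  have "mart p q c (u(Suc n := b)) n = mart p q c u n"
    by (rule mart_cong) auto
  then show ?thesis
    by (simp add: mart_def parent_upd)
qed

lemma tr_sum: "tr p q a 0 + tr p q a 1 = 1"
  by (simp add: tr_def)

lemma tr_nonneg: "0 \<le> p \<Longrightarrow> p \<le> 1 \<Longrightarrow> 0 \<le> q \<Longrightarrow> q \<le> 1 \<Longrightarrow> 0 \<le> tr p q a b"
  by (simp add: tr_def)

lemma mass_nonneg: "0 \<le> p \<Longrightarrow> p \<le> 1 \<Longrightarrow> 0 \<le> q \<Longrightarrow> q \<le> 1 \<Longrightarrow> 0 \<le> mass p q u n"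
  unfolding mass_def by (intro prod_nonneg ballI tr_nonneg)

lemma sum_mass: "(\<Sum>u\<in>words n. mass p q u n) = 1"
proof (induction n)
  case 0
  show ?case by (simp add: words_0 mass_def)
next
  case (Suc n)
  then show ?case
    by (simp only: sum_words_Suc mass_upd distrib_left[symmetric] tr_sum mult_1_right)
qed

text \<open>Kolmogorov consistency: the two transition probabilities out of a state add up to 1, so
  summing over one more letter changes nothing. Words of different lengths can thus be compared
  without a measure on sequences.\<close>

lemma sum_mass_cylinder:
  assumes "v \<in> words n" "n \<le> m"
  shows "(\<Sum>u\<in>words m. if restrict u {1..n} = v then mass p q u m else 0) = mass p q v n"
  using assms(2)
proof (induction m rule: dec_induct)
  case base
  have "(\<Sum>u\<in>words n. if restrict u {1..n} = v then mass p q u n else 0) =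
        (\<Sum>u\<in>words n. if v = u then mass p q u n else 0)"
    by (rule sum.cong) (auto simp: restrict_self[unfolded One_nat_def])
  also have "\<dots> = mass p q v n"
    using assms by simp
  finally show ?case .
next
  case (step m)
  have "restrict (u(Suc m := b)) {1..n} = restrict u {1..n}" for u :: "nat \<Rightarrow> nat" and b
    using step by (auto simp: restrict_def)
  moreover have "mass p q u m * tr p q a 0 + mass p q u m * tr p q a (Suc 0) = mass p q u m" for u a
    using tr_sum[of p q a] by (simp add: distrib_left[symmetric])
  ultimately show ?case
    using step by (simp add: sum_words_Suc mass_upd if_distrib[where f = "\<lambda>x. x + _"] cong: if_cong)
qed

section \<open>Exponential moments and a large deviation bound\<close>

lemma exp_le_quadratic:
  fixes x :: real
  assumes "\<bar>x\<bar> \<le> 1"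
  shows "exp x \<le> 1 + x + x\<^sup>2"
proof (cases "x \<ge> 0")
  case True
  then show ?thesis
    using assms exp_bound[of x] by simp
next
  case False
  \<comment> \<open>For negative \<open>x\<close> the bound comes from (1 + x + x^2) (1 - x) = 1 -
    x^3 \<ge> 1 and 1 - x \<le> exp (-x).\<close>
  have "1 - x \<le> exp (- x)"
    using exp_ge_add_one_self[of "- x"] by simp
  then have "(1 + x + x\<^sup>2) * (1 - x) \<le> (1 + x + x\<^sup>2) * exp (- x)"
    by (rule mult_left_mono) (use assms in \<open>auto intro: add_nonneg_nonneg\<close>)
  moreover have "(1 + x + x\<^sup>2) * (1 - x) = 1 - x ^ 3"
    by (simp add: power2_eq_square power3_eq_cube algebra_simps)
  moreover have "x ^ 3 \<le> 0"
    using False by (simp add: power_le_zero_eq)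
  ultimately have "1 \<le> (1 + x + x\<^sup>2) * exp (- x)"
    by linarith
  then show ?thesis
    by (simp add: exp_minus field_simps)
qed

text \<open>For a centred two-point variable the linear terms of the quadratic bound cancel, and the
  variance r (1 - r) is at most 1.\<close>

lemma centred_exp_bound:
  fixes r y :: real
  assumes "0 \<le> r" "r \<le> 1" "\<bar>y\<bar> \<le> 1"
  shows "(1 - r) * exp (y * (0 - r)) + r * exp (y * (1 - r)) \<le> exp (y\<^sup>2)"
proof -
  have b: "\<bar>y * z\<bar> \<le> 1" if "\<bar>z\<bar> \<le> 1" for z
    using assms that by (simp add: abs_mult mult_le_one)
  have "(1 - r) * exp (y * (0 - r)) + r * exp (y * (1 - r)) \<le>
        (1 - r) * (1 + y * (0 - r) + (y * (0 - r))\<^sup>2) + r * (1 + y * (1 - r) + (y * (1 - r))\<^sup>2)"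
    using assms by (intro add_mono mult_left_mono exp_le_quadratic b) auto
  also have "\<dots> = 1 + y\<^sup>2 * (r * (1 - r))"
    by (simp add: power2_eq_square algebra_simps)
  also have "\<dots> \<le> 1 + y\<^sup>2 * 1"
    using assms by (intro add_left_mono mult_left_mono mult_le_one) auto
  also have "\<dots> \<le> exp (y\<^sup>2)"
    using exp_ge_add_one_self[of "y\<^sup>2"] by simp
  finally show ?thesis .
qed

text \<open>The last letter is summed out first: whatever the prefix, its centred increment
  contributes a factor of at most exp (t^2).\<close>

lemma exponential_moment:
  assumes pq: "0 \<le> p" "p \<le> 1" "0 \<le> q" "q \<le> 1" and c: "\<And>a. \<bar>c a\<bar> \<le> 1" and t: "\<bar>t\<bar> \<le> 1"
  shows "(\<Sum>u\<in>words n. mass p q u n * exp (t * mart p q c u n)) \<le> exp (t\<^sup>2 * n)"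
proof (induction n)
  case 0
  show ?case by (simp add: words_0 mass_def mart_def)
next
  case (Suc n)
  have step: "(\<Sum>b\<in>{0,1}. mass p q (u(Suc n := b)) (Suc n) * exp (t * mart p q c (u(Suc n := b)) (Suc n)))
     \<le> mass p q u n * exp (t * mart p q c u n) * exp (t\<^sup>2)" for u
  proof -
    define a where "a = parent u (Suc n)"
    define r where "r = tr p q a (Suc 0)"
    have r: "0 \<le> r" "r \<le> 1" "tr p q a 0 = 1 - r"
      using pq by (auto simp: r_def tr_def)
    have exp_eq: "exp (t * (mart p q c u n + c a * z)) = exp (t * mart p q c u n) * exp (t * c a * z)" for z
      by (simp add: exp_add[symmetric] algebra_simps)
    have y: "\<bar>t * c a\<bar> \<le> \<bar>t\<bar>"
      using c[of a] mult_left_le[of "\<bar>c a\<bar>" "\<bar>t\<bar>"] by (simp add: abs_mult)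
    have "(\<Sum>b\<in>{0,1}. mass p q (u(Suc n := b)) (Suc n) * exp (t * mart p q c (u(Suc n := b)) (Suc n)))
      = mass p q u n * exp (t * mart p q c u n) *
        ((1 - r) * exp (t * c a * (0 - r)) + r * exp (t * c a * (1 - r)))"
      by (simp add: mass_upd mart_upd exp_eq r(3) flip: a_def r_def) (simp add: algebra_simps)
    also have "\<dots> \<le> mass p q u n * exp (t * mart p q c u n) * exp ((t * c a)\<^sup>2)"
      using r t y mass_nonneg[OF pq] by (intro mult_left_mono centred_exp_bound) auto
    also have "\<dots> \<le> mass p q u n * exp (t * mart p q c u n) * exp (t\<^sup>2)"
      using y mass_nonneg[OF pq] by (intro mult_left_mono) (auto simp: abs_le_square_iff)
    finally show ?thesis .
  qed
  have "(\<Sum>u\<in>words (Suc n). mass p q u (Suc n) * exp (t * mart p q c u (Suc n))) \<le>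
        (\<Sum>u\<in>words n. mass p q u n * exp (t * mart p q c u n) * exp (t\<^sup>2))"
    unfolding sum_words_Suc using step by (intro sum_mono) simp
  also have "\<dots> \<le> exp (t\<^sup>2 * n) * exp (t\<^sup>2)"
    using Suc by (simp add: sum_distrib_right[symmetric])
  also have "\<dots> = exp (t\<^sup>2 * Suc n)"
    by (simp add: exp_add[symmetric] algebra_simps)
  finally show ?case .
qed

text \<open>A Chernoff bound. The threshold n^(3/4) is o(n), yet large enough for the resulting
  masses to be summable over \<open>n\<close>.\<close>

lemma mart_deviation:
  assumes pq: "0 \<le> p" "p \<le> 1" "0 \<le> q" "q \<le> 1" and c: "\<And>a. \<bar>c a\<bar> \<le> 1" and "n > 0"
  shows "(\<Sum>u | u \<in> words n \<and> real n powr (3/4) \<le> mart p q c u n. mass p q u n) \<le> exp (- sqrt n / 4)"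
proof -
  \<comment> \<open>With this choice the moment bound is exp (sqrt n / 4), while the threshold gives
    the factor exp (sqrt n / 2).\<close>
  define t where "t = real n powr (-1/4) / 2"
  have "real n powr (-1/4) \<le> real n powr 0"
    using \<open>n > 0\<close> by (intro powr_mono) auto
  then have t: "0 < t" "\<bar>t\<bar> \<le> 1"
    using \<open>n > 0\<close> by (auto simp: t_def)
  have e1: "t\<^sup>2 * n = sqrt n / 4"
    using \<open>n > 0\<close> by (simp add: t_def power_divide powr_half_sqrt[symmetric] powr_add[symmetric]
        powr_power powr_mult_base mult.commute)
  have e2: "t * real n powr (3/4) = sqrt n / 2"
    using \<open>n > 0\<close> by (simp add: t_def powr_half_sqrt[symmetric] powr_add[symmetric])
  have "exp (sqrt n / 2) * (\<Sum>u | u \<in> words n \<and> real n powr (3/4) \<le> mart p q c u n. mass p q u n)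
     \<le> (\<Sum>u | u \<in> words n \<and> real n powr (3/4) \<le> mart p q c u n. mass p q u n * exp (t * mart p q c u n))"
    unfolding sum_distrib_left e2[symmetric]
    using t mass_nonneg[OF pq] by (intro sum_mono) (auto simp: mult.commute intro!: mult_left_mono)
  also have "\<dots> \<le> (\<Sum>u\<in>words n. mass p q u n * exp (t * mart p q c u n))"
    using mass_nonneg[OF pq] by (intro sum_mono2) auto
  also have "\<dots> \<le> exp (sqrt n / 4)"
    using exponential_moment[of p q c t n, OF pq c t(2)] by (simp only: e1)
  finally have "exp (sqrt n / 2) * (\<Sum>u | u \<in> words n \<and> real n powr (3/4) \<le> mart p q c u n. mass p q u n)
     \<le> exp (sqrt n / 2) * exp (- sqrt n / 4)"
    by (simp add: exp_add[symmetric])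
  then show ?thesis
    by simp
qed

section \<open>Covers by cylinders of small total mass\<close>

text \<open>A union bound: if every word of length \<open>N\<close> had a prefix in
  \<open>G\<close>, the cylinders of these finitely many prefixes would carry the whole mass 1,
  against c < 1.\<close>

lemma exists_avoiding_word:
  assumes pq: "0 \<le> p" "p \<le> 1" "0 \<le> q" "q \<le> 1"
    and G: "G \<subseteq> Sigma UNIV words"
    and le: "\<And>F. finite F \<Longrightarrow> F \<subseteq> G \<Longrightarrow> (\<Sum>(n, v)\<in>F. mass p q v n) \<le> c" and "c < 1"
  shows "\<exists>u\<in>words N. \<forall>n\<le>N. (n, restrict u {1..n}) \<notin> G"
proof (rule ccontr)
  assume none: "\<not> ?thesis"
  define F where "F = {(n, v) \<in> G. n \<le> N}"
  have "F \<subseteq> Sigma {..N} words"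
    using G by (auto simp: F_def)
  then have fin: "finite F"
    by (rule finite_subset) auto
  have "1 = (\<Sum>u\<in>words N. mass p q u N)"
    by (simp add: sum_mass)
  also have "\<dots> \<le> (\<Sum>u\<in>words N. \<Sum>(n, v)\<in>F. if restrict u {1..n} = v then mass p q u N else 0)"
  proof (rule sum_mono)
    fix u assume "u \<in> words N"
    then obtain n where n: "n \<le> N" "(n, restrict u {1..n}) \<in> G"
      using none by auto
    have "(\<Sum>(n, v)\<in>{(n, restrict u {1..n})}. if restrict u {1..n} = v then mass p q u N else 0) \<le>
          (\<Sum>(n, v)\<in>F. if restrict u {1..n} = v then mass p q u N else 0)"
      using fin n mass_nonneg[OF pq] by (intro sum_mono2) (auto simp: F_def split: if_split_asm)
    then show "mass p q u N \<le> (\<Sum>(n, v)\<in>F. if restrict u {1..n} = v then mass p q u N else 0)"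
      by simp
  qed
  also have "\<dots> = (\<Sum>(n, v)\<in>F. \<Sum>u\<in>words N. if restrict u {1..n} = v then mass p q u N else 0)"
    unfolding split_def by (rule sum.swap)
  also have "\<dots> = (\<Sum>(n, v)\<in>F. mass p q v n)"
    using G by (intro sum.cong refl) (auto simp: F_def sum_mass_cylinder simp del: One_nat_def)
  also have "\<dots> \<le> c"
    using fin by (intro le) (auto simp: F_def)
  finally show False
    using \<open>c < 1\<close> by simp
qed

text \<open>Koenig's lemma for the binary tree of words none of whose prefixes is in
  \<open>G\<close>.\<close>

lemma koenig_words:
  assumes avoid: "\<And>N. \<exists>u\<in>words N. \<forall>n\<le>N. (n, restrict u {1..n}) \<notin> G"
  obtains \<omega> where "\<omega> \<in> binary_seqs" "\<And>n. (n, restrict \<omega> {1..n}) \<notin> G"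
proof -
  define good where "good N u \<longleftrightarrow> u \<in> words N \<and> (\<forall>m\<le>N. (m, restrict u {1..m}) \<notin> G)" for N u
  \<comment> \<open>\<open>ext\<close> marks the prefixes that continue to good words of every
    length; an infinite branch stays among them.\<close>
  define ext where "ext n v \<longleftrightarrow> (\<forall>N\<ge>n. \<exists>u. good N u \<and> restrict u {1..n} = v)" for n v
  have good_restrict: "good M (restrict u {1..M})" if "good N u" "M \<le> N" for M N u
    using that restrict_words[of u N M]
    by (auto simp: good_def min_def simp del: One_nat_def)
  have "ext 0 (\<lambda>_. undefined)"
    unfolding ext_def
  proof (intro allI impI)
    fix N
    show "\<exists>u. good N u \<and> restrict u {1..0} = (\<lambda>_. undefined)"
      using avoid[of N] by (auto simp: good_def restrict_def)
  qed
  moreover have "\<exists>w. ext (Suc n) w \<and> restrict w {1..n} = v" if v: "ext n v" for n v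
  proof -
    have "\<exists>b. ext (Suc n) (v(Suc n := b))"
    proof (rule ccontr)
      assume "\<not> ?thesis"
      then have "\<forall>b. \<exists>N\<ge>Suc n. \<forall>u. good N u \<longrightarrow> restrict u {1..Suc n} \<noteq> v(Suc n := b)"
        unfolding ext_def by blast
      then obtain M where M: "\<And>b. Suc n \<le> M b"
        "\<And>b u. good (M b) u \<Longrightarrow> restrict u {1..Suc n} \<noteq> v(Suc n := b)"
        by metis
      \<comment> \<open>If neither child of \<open>v\<close> had this property, each would fail at
        some length. A good word of the larger length, cut at the failing length of its own next
        letter, contradicts that failure.\<close>
      define N where "N = max (M 0) (M 1)"
      have "Suc n \<le> N"
        using M(1)[of 0] by (auto simp: N_def)
      then obtain u where u: "good N u" "restrict u {1..n} = v"
        using v unfolding ext_def by (meson Suc_leD)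
      define b where "b = u (Suc n)"
      have "b = 0 \<or> b = 1"
        using u(1) \<open>Suc n \<le> N\<close> words_cases[of u N "Suc n"] by (auto simp: b_def good_def)
      then have "M b \<le> N"
        by (auto simp: N_def)
      then have "good (M b) (restrict u {1..M b})"
        using u good_restrict by blast
      moreover have "restrict (restrict u {1..M b}) {1..Suc n} = v(Suc n := b)"
        using M(1)[of b] unfolding u(2)[symmetric] b_def by (auto simp: restrict_def fun_eq_iff)
      ultimately show False
        using M(2) by blast
    qed
    moreover have "restrict (v(Suc n := b)) {1..n} = v" for b
    proof -
      obtain u where "restrict u {1..n} = v"
        using v unfolding ext_def by blast
      then show ?thesis
        by (auto simp: restrict_def)
    qed
    ultimately show ?thesis
      by blast
  qed
  ultimately obtain f where f: "\<And>n. ext n (f n)" "\<And>n. restrict (f (Suc n)) {1..n} = f n"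
    using dependent_nat_choice[of ext "\<lambda>n v w. restrict w {1..n} = v"] by metis
  have good_f: "good n (f n)" for n
    using f(1)[of n] restrict_self unfolding ext_def good_def by (metis order_refl)
  have f_diag: "f n k = f k k" if "1 \<le> k" "k \<le> n" for n k
    using that(2)
  proof (induction n rule: dec_induct)
    case (step n)
    then show ?case
      using fun_cong[OF f(2)[of n], of k] that by (simp add: restrict_def)
  qed simp
  \<comment> \<open>Coordinates are read off the diagonal; coordinate 0 is \<open>undefined\<close>
    because \<open>binary_seqs\<close> is extensional over {1..}.\<close>
  define \<omega> where "\<omega> = (\<lambda>k. if 1 \<le> k then f k k else undefined)"
  have restr: "restrict \<omega> {1..n} = f n" for n
  proof
    fix k show "restrict \<omega> {1..n} k = f n k"
      using good_f[of n] f_diag[of k n]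
      by (auto simp: \<omega>_def restrict_def good_def words_def PiE_def extensional_def)
  qed
  show thesis
  proof (rule that)
    have "f k k \<in> {0, 1}" if "1 \<le> k" for k
      using good_f[of k] that by (auto simp: good_def words_def)
    then show "\<omega> \<in> binary_seqs"
      unfolding binary_seqs_def \<omega>_def by (intro PiE_I) auto
    show "(n, restrict \<omega> {1..n}) \<notin> G" for n
    proof -
      have "f n \<in> words n" "(n, restrict (f n) {1..n}) \<notin> G"
        using good_f[of n] unfolding good_def by blast+
      then show ?thesis
        by (simp only: restr restrict_self not_False_eq_True)
    qed
  qed
qed

text \<open>C / (1 - r) is the fixed point of x = r x + C, and the linear term at most doubles
  because r * 2\<eta> * (n / 2) + \<eta> n \<le> 2\<eta> n. This turns relations between
  \<open>n\<close> and \<open>n div 2\<close> into linear bounds.\<close>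

lemma rate_recursion:
  fixes e :: "nat \<Rightarrow> real" and r \<eta> C :: real
  assumes "0 \<le> r" "r < 1" "0 \<le> \<eta>" "0 \<le> C"
    and e: "e 0 = 0" "\<And>n. n > 0 \<Longrightarrow> e n \<le> r * e (n div 2) + \<eta> * n + C"
  shows "e n \<le> 2 * \<eta> * n + C / (1 - r)"
proof (induction n rule: less_induct)
  case (less n)
  show ?case
  proof (cases "n = 0")
    case True
    then show ?thesis using assms by simp
  next
    case False
    have half: "real (n div 2) \<le> n / 2"
      by linarith
    have "r * e (n div 2) \<le> r * (2 * \<eta> * real (n div 2) + C / (1 - r))"
      using False assms by (intro mult_left_mono less) auto
    also have "\<dots> \<le> r * (2 * \<eta> * (n / 2) + C / (1 - r))"
      using assms by (intro mult_left_mono add_right_mono) (use half in auto)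
    also have "\<dots> \<le> \<eta> * n + r * (C / (1 - r))"
      using assms mult_right_mono[of r 1 "\<eta> * n"] by (simp add: algebra_simps)
    finally have "e n \<le> 2 * \<eta> * n + (r * (C / (1 - r)) + C)"
      using e(2)[of n] False by (simp add: algebra_simps)
    also have "r * (C / (1 - r)) + C = C / (1 - r)"
      using assms by (simp add: field_simps)
    finally show ?thesis .
  qed
qed

section \<open>Recursions for the numbers of ones and of pairs\<close>

lemma sum_parent:
  "(\<Sum>k=1..n. real (parent \<omega> k)) = ones \<omega> (n div 2)"
proof (induction n)
  case 0
  show ?case by (simp add: ones_def)
next
  case (Suc n)
  show ?case
  proof (cases "even (Suc n)")
    case True
    then obtain m where m: "n = 2 * m + 1"
      by (metis oddE even_Suc)
    then have "n div 2 = m" "Suc n div 2 = Suc m"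
      by auto
    then show ?thesis
      using Suc by (simp add: parent_def ones_def m)
  next
    case False
    then have "Suc n div 2 = n div 2"
      by presburger
    then show ?thesis
      using Suc False by (simp add: parent_def)
  qed
qed

lemma pairs_double: "pairs \<omega> (2 * n) = (\<Sum>k=1..n. real (\<omega> k * \<omega> (2 * k)))"
proof (induction n)
  case (Suc n)
  have "pairs \<omega> (2 * Suc n) = pairs \<omega> (2 * n) + real (parent \<omega> (2 * n + 1) * \<omega> (2 * n + 1))
      + real (parent \<omega> (2 * n + 2) * \<omega> (2 * n + 2))"
    by (simp add: pairs_def)
  also have "\<dots> = pairs \<omega> (2 * n) + real (\<omega> (Suc n) * \<omega> (2 * Suc n))"
    by (simp add: parent_def)
  finally show ?case
    using Suc by simp
qed (simp add: pairs_def)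

text \<open>On states 0 and 1 the probability of moving to 1 is affine in the parent a, namely p +
  (q - p) a. Each j with 1 \<le> j \<le> n div 2 is the parent of exactly one index up to
  \<open>n\<close>, namely 2j, so the parents add up to the ones up to
  \<open>n div 2\<close>.\<close>

lemma ones_mart:
  assumes "\<And>k. 1 \<le> k \<Longrightarrow> k \<le> n \<Longrightarrow> \<omega> k = 0 \<or> \<omega> k = 1"
  shows "ones \<omega> n = mart p q (\<lambda>_. 1) \<omega> n + p * n + (q - p) * ones \<omega> (n div 2)"
proof -
  have "ones \<omega> n - mart p q (\<lambda>_. 1) \<omega> n = (\<Sum>k=1..n. tr p q (parent \<omega> k) 1)"
    by (simp add: ones_def mart_def sum_subtractf)
  also have "\<dots> = (\<Sum>k=1..n. p + (q - p) * real (parent \<omega> k))"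
  proof (rule sum.cong)
    fix k assume "k \<in> {1..n}"
    then have "parent \<omega> k = 0 \<or> parent \<omega> k = 1"
      using parent_le_1[of n \<omega> k] assms by auto
    then show "tr p q (parent \<omega> k) 1 = p + (q - p) * real (parent \<omega> k)"
      by (auto simp: tr_def)
  qed simp
  also have "\<dots> = p * n + (q - p) * ones \<omega> (n div 2)"
    by (simp only: sum.distrib sum_distrib_left[symmetric] sum_parent) simp
  finally show ?thesis
    by simp
qed

text \<open>The test function selects the parents in state 1, the only ones contributing to
  \<open>pairs\<close>; each of them has drift \<open>q\<close>.\<close>

lemma pairs_mart:
  assumes "\<And>k. 1 \<le> k \<Longrightarrow> k \<le> n \<Longrightarrow> \<omega> k = 0 \<or> \<omega> k = 1"
  shows "pairs \<omega> n = mart p q (\<lambda>a. if a = 0 then 0 else 1) \<omega> n + q * ones \<omega> (n div 2)"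
proof -
  have "pairs \<omega> n - mart p q (\<lambda>a. if a = 0 then 0 else 1) \<omega> n = (\<Sum>k=1..n. q * real (parent \<omega> k))"
    unfolding pairs_def mart_def sum_subtractf[symmetric]
  proof (rule sum.cong)
    fix k assume "k \<in> {1..n}"
    then have "parent \<omega> k = 0 \<or> parent \<omega> k = 1"
      using parent_le_1[of n \<omega> k] assms by auto
    then show "real (parent \<omega> k * \<omega> k) - (if parent \<omega> k = 0 then 0 else 1) *
        (real (\<omega> k) - tr p q (parent \<omega> k) 1) = q * real (parent \<omega> k)"
      by (auto simp: tr_def)
  qed simp
  also have "\<dots> = q * ones \<omega> (n div 2)"
    by (simp only: sum_distrib_left[symmetric] sum_parent)
  finally show ?thesis
    by simp
qed

section \<open>Geometry of the iterated function system\<close>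

definition rate :: "real \<Rightarrow> real \<Rightarrow> nat \<Rightarrow> real" where
  "rate l0 l1 a = (if a = 0 then l0 else l1)"

definition len :: "real \<Rightarrow> real \<Rightarrow> (nat \<Rightarrow> nat) \<Rightarrow> nat \<Rightarrow> real" where
  "len l0 l1 \<omega> n = exp (- (\<Sum>k=1..n. rate l0 l1 (\<omega> k)))"

definition left :: "real \<Rightarrow> real \<Rightarrow> (nat \<Rightarrow> nat) \<Rightarrow> nat \<Rightarrow> real" where
  "left l0 l1 \<omega> n = ifs_comp l0 l1 \<omega> n 0"

lemma len_pos: "0 < len l0 l1 \<omega> n"
  by (simp add: len_def)

lemma len_0 [simp]: "len l0 l1 \<omega> 0 = 1"
  by (simp add: len_def)

lemma len_Suc: "len l0 l1 \<omega> (Suc n) = len l0 l1 \<omega> n * exp (- rate l0 l1 (\<omega> (Suc n)))"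
  by (simp add: len_def exp_add[symmetric] add.commute)

lemma len_cong: "(\<And>k. 1 \<le> k \<Longrightarrow> k \<le> n \<Longrightarrow> u k = v k) \<Longrightarrow> len l0 l1 u n = len l0 l1 v n"
  unfolding len_def by (auto intro!: sum.cong)

text \<open>The composition maps [0,1] onto the basic interval with left end \<open>left\<close> and
  length \<open>len\<close>; all later geometry uses only these two numbers.\<close>

lemma ifs_comp_affine: "ifs_comp l0 l1 \<omega> n x = left l0 l1 \<omega> n + len l0 l1 \<omega> n * x"
proof (induction n arbitrary: x)
  case 0
  show ?case by (simp add: left_def)
next
  case (Suc n)
  have "ifs_comp l0 l1 \<omega> (Suc n) x = left l0 l1 \<omega> n + len l0 l1 \<omega> n * ifs l0 l1 (\<omega> (Suc n)) x" for x
    using Suc by simp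
  then show ?case
    unfolding left_def[of _ _ _ "Suc n"]
    by (simp add: len_Suc ifs_def rate_def algebra_simps)
qed

lemma left_Suc:
  "left l0 l1 \<omega> (Suc n) = left l0 l1 \<omega> n + len l0 l1 \<omega> n * (if \<omega> (Suc n) = 0 then 0 else 1 - exp (- l1))"
  unfolding left_def[of _ _ _ "Suc n"] by (simp add: ifs_comp_affine ifs_def)

lemma left_0 [simp]: "left l0 l1 \<omega> 0 = 0"
  by (simp add: left_def)

lemma left_cong: "(\<And>k. 1 \<le> k \<Longrightarrow> k \<le> n \<Longrightarrow> u k = v k) \<Longrightarrow> left l0 l1 u n = left l0 l1 v n"
proof (induction n)
  case (Suc n)
  then show ?case
    using len_cong[of n u v] by (simp add: left_Suc)
qed simp

text \<open>By \<open>osc\<close> the images of [0,1] under the two maps, [0, exp (-l0)] and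
  [1 - exp (-l1), 1], meet in at most one point.\<close>

locale ifs_pair =
  fixes l0 l1 :: real
  assumes l0: "l0 > 0" and l1: "l1 > 0" and osc: "exp (- l0) + exp (- l1) \<le> 1"
begin

lemma left_mono: "m \<le> n \<Longrightarrow> left l0 l1 \<omega> m \<le> left l0 l1 \<omega> n"
proof (induction n rule: dec_induct)
  case (step n)
  moreover have "left l0 l1 \<omega> n \<le> left l0 l1 \<omega> (Suc n)"
    using l1 len_pos[of l0 l1 \<omega> n] by (simp add: left_Suc)
  ultimately show ?case by simp
qed simp

lemma right_antimono:
  "m \<le> n \<Longrightarrow> left l0 l1 \<omega> n + len l0 l1 \<omega> n \<le> left l0 l1 \<omega> m + len l0 l1 \<omega> m"
proof (induction n rule: dec_induct)
  case (step n)
  have "len l0 l1 \<omega> n * exp (- l0) \<le> len l0 l1 \<omega> n * 1"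
    using l0 len_pos[of l0 l1 \<omega> n] by (intro mult_left_mono) auto
  then have "left l0 l1 \<omega> (Suc n) + len l0 l1 \<omega> (Suc n) \<le> left l0 l1 \<omega> n + len l0 l1 \<omega> n"
    by (simp add: left_Suc len_Suc rate_def algebra_simps)
  then show ?case
    using step by simp
qed simp

lemma len_antimono: "m \<le> n \<Longrightarrow> len l0 l1 \<omega> n \<le> len l0 l1 \<omega> m"
  using left_mono[of m n \<omega>] right_antimono[of m n \<omega>] by simp

text \<open>The basic intervals are nested, so the left ends increase and stay below every right
  end. In particular the \<open>lim\<close> in \<open>natural_proj\<close> is a genuine
  limit.\<close>

lemma natural_proj_bounds:
  "natural_proj l0 l1 \<omega> \<in> {left l0 l1 \<omega> n..left l0 l1 \<omega> n + len l0 l1 \<omega> n}"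
proof -
  have ub: "left l0 l1 \<omega> m \<le> left l0 l1 \<omega> n + len l0 l1 \<omega> n" for m n
  proof -
    have "left l0 l1 \<omega> m \<le> left l0 l1 \<omega> (max m n)"
      by (rule left_mono) simp
    also have "\<dots> \<le> left l0 l1 \<omega> (max m n) + len l0 l1 \<omega> (max m n)"
      using len_pos[of l0 l1 \<omega> "max m n"] by simp
    also have "\<dots> \<le> left l0 l1 \<omega> n + len l0 l1 \<omega> n"
      by (rule right_antimono) simp
    finally show ?thesis .
  qed
  have "incseq (left l0 l1 \<omega>)"
    by (simp add: incseq_def left_mono)
  moreover have "\<forall>m. left l0 l1 \<omega> m \<le> 1"
    using ub[of _ 0] by simp
  ultimately obtain L where L: "left l0 l1 \<omega> \<longlonglongrightarrow> L" "\<And>m. left l0 l1 \<omega> m \<le> L"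
    using incseq_convergent by metis
  then have "natural_proj l0 l1 \<omega> = L"
    by (simp add: natural_proj_def limI left_def[abs_def])
  moreover have "L \<le> left l0 l1 \<omega> n + len l0 l1 \<omega> n"
    using L(1) ub by (intro LIMSEQ_le_const2) auto
  ultimately show ?thesis
    using L(2) by simp
qed

lemma len_le: "len l0 l1 \<omega> n \<le> exp (- (min l0 l1 * n))"
proof -
  have "(\<Sum>k=1..n. min l0 l1) \<le> (\<Sum>k=1..n. rate l0 l1 (\<omega> k))"
    by (rule sum_mono) (simp add: rate_def)
  then show ?thesis
    by (simp add: len_def mult.commute)
qed

lemma len_ge: "exp (- (max l0 l1 * n)) \<le> len l0 l1 \<omega> n"
proof -
  have "(\<Sum>k=1..n. rate l0 l1 (\<omega> k)) \<le> (\<Sum>k=1..n. max l0 l1)"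
    by (rule sum_mono) (simp add: rate_def)
  then show ?thesis
    by (simp add: len_def mult.commute)
qed

text \<open>At the first difference the words enter different children of one interval;
  \<open>osc\<close> orders the children, and nesting passes the order on to all
  descendants.\<close>

lemma left_separated:
  assumes "\<And>k. 1 \<le> k \<Longrightarrow> k \<le> n \<Longrightarrow> u k = v k" "u (Suc n) = 0" "v (Suc n) \<noteq> 0" "Suc n \<le> i" "Suc n \<le> j"
  shows "left l0 l1 u i + len l0 l1 u i \<le> left l0 l1 v j"
proof -
  have "left l0 l1 u i + len l0 l1 u i \<le> left l0 l1 u (Suc n) + len l0 l1 u (Suc n)"
    using assms by (intro right_antimono)
  also have "\<dots> = left l0 l1 u n + len l0 l1 u n * exp (- l0)"
    using assms by (simp add: left_Suc len_Suc rate_def)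
  also have "\<dots> \<le> left l0 l1 u n + len l0 l1 u n * (1 - exp (- l1))"
    using osc len_pos[of l0 l1 u n] by (intro add_left_mono mult_left_mono) auto
  also have "\<dots> = left l0 l1 v (Suc n)"
    using assms left_cong[of n u v] len_cong[of n u v] by (simp add: left_Suc)
  also have "\<dots> \<le> left l0 l1 v j"
    using assms by (intro left_mono)
  finally show ?thesis .
qed

section \<open>Words stopped at a given scale\<close>

definition stop_words :: "real \<Rightarrow> (nat \<times> (nat \<Rightarrow> nat)) set" where
  "stop_words r = {(n, v). v \<in> words n \<and> 0 < n \<and> len l0 l1 v n \<le> r \<and> r < len l0 l1 v (n - 1)}"

text \<open>A word is stopped when its interval first becomes no longer than \<open>r\<close>; the
  last letter shrinks it by a factor of at least \<open>exp (- max l0 l1)\<close>, so the length is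
  comparable to \<open>r\<close>.\<close>

lemma stop_words_len:
  assumes "(n, v) \<in> stop_words r"
  shows "exp (- max l0 l1) * r < len l0 l1 v n" "len l0 l1 v n \<le> r"
proof -
  obtain m where m: "n = Suc m" "r < len l0 l1 v m"
    using assms by (cases n) (auto simp: stop_words_def)
  have "exp (- max l0 l1) * r < exp (- max l0 l1) * len l0 l1 v m"
    using m by simp
  also have "\<dots> \<le> exp (- rate l0 l1 (v n)) * len l0 l1 v m"
    using len_pos[of l0 l1 v m] by (intro mult_right_mono) (auto simp: rate_def)
  finally show "exp (- max l0 l1) * r < len l0 l1 v n"
    by (simp add: m len_Suc mult.commute)
  show "len l0 l1 v n \<le> r"
    using assms by (simp add: stop_words_def)
qed

text \<open>Lengths decrease along a word, so every proper prefix of a stopped word is still longer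
  than \<open>r\<close> and is not stopped itself.\<close>

lemma stop_words_incomparable:
  assumes "(n, v) \<in> stop_words r" "(m, w) \<in> stop_words r" "n \<le> m"
    and eq: "\<And>k. 1 \<le> k \<Longrightarrow> k \<le> n \<Longrightarrow> v k = w k"
  shows "(n, v) = (m, w)"
proof -
  have "n = m"
  proof (rule ccontr)
    assume "n \<noteq> m"
    then have "len l0 l1 w (m - 1) \<le> len l0 l1 w n"
      using assms by (intro len_antimono) simp
    also have "\<dots> = len l0 l1 v n"
      using eq by (intro len_cong) simp
    finally show False
      using assms by (auto simp: stop_words_def)
  qed
  moreover have "v = w"
  proof
    fix k
    have "v k = w k" if "k \<notin> {1..n}"
      using that assms(1,2) \<open>n = m\<close>
      by (auto simp: stop_words_def words_def PiE_def extensional_def)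
    then show "v k = w k"
      using eq[of k] by auto
  qed
  ultimately show ?thesis by simp
qed

text \<open>Distinct stopped words have a first difference, where one interval ends before the other
  begins; the left ends are then at least the length of the lower interval apart.\<close>

lemma stop_words_separated:
  assumes "(n, v) \<in> stop_words r" "(m, w) \<in> stop_words r" "(n, v) \<noteq> (m, w)"
  shows "exp (- max l0 l1) * r < \<bar>left l0 l1 v n - left l0 l1 w m\<bar>"
proof -
  have "\<exists>k. 1 \<le> k \<and> k \<le> min n m \<and> v k \<noteq> w k"
  proof (rule ccontr)
    assume "\<not> ?thesis"
    then show False
      using assms stop_words_incomparable[of n v r m w] stop_words_incomparable[of m w r n v]
      by (cases "n \<le> m") (auto simp: min_def)
  qed
  then obtain k where k: "1 \<le> k" "k \<le> min n m" "v k \<noteq> w k"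
    and less: "\<And>j. j < k \<Longrightarrow> \<not> (1 \<le> j \<and> j \<le> min n m \<and> v j \<noteq> w j)"
    unfolding exists_least_iff[of "\<lambda>k. 1 \<le> k \<and> k \<le> min n m \<and> v k \<noteq> w k"] by blast
  obtain i where i: "k = Suc i"
    using k by (cases k) auto
  have eq: "v j = w j" if "1 \<le> j" "j \<le> i" for j
    using less[of j] that k i by auto
  have "v k = 0 \<or> v k = 1" "w k = 0 \<or> w k = 1"
    using assms k words_cases[of v n k] words_cases[of w m k] by (auto simp: stop_words_def)
  then consider "v k = 0" "w k \<noteq> 0" | "w k = 0" "v k \<noteq> 0"
    using k by auto
  then show ?thesis
  proof cases
    case 1
    then have "left l0 l1 v n + len l0 l1 v n \<le> left l0 l1 w m"
      using eq k i by (intro left_separated[of i]) auto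
    then show ?thesis
      using stop_words_len[OF assms(1)] by simp
  next
    case 2
    then have "left l0 l1 w m + len l0 l1 w m \<le> left l0 l1 v n"
      using eq k i by (intro left_separated[of i]) auto
    then show ?thesis
      using stop_words_len[OF assms(2)] by simp
  qed
qed

definition stop_words_meeting :: "real set \<Rightarrow> real \<Rightarrow> (nat \<times> (nat \<Rightarrow> nat)) set" where
  "stop_words_meeting U r =
     {(n, v) \<in> stop_words r. {left l0 l1 v n..left l0 l1 v n + len l0 l1 v n} \<inter> U \<noteq> {}}"

text \<open>Left end points of the stopped intervals are separated by more than \<open>exp (- max l0 l1) * r\<close>, and
  all those meeting \<open>U\<close> lie in an interval of length \<open>3 * r\<close>.\<close>

lemma card_stop_words_meeting:
  assumes "bounded U" "diameter U \<le> r" "0 < r" and F: "F \<subseteq> stop_words_meeting U r"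
  shows "real (card F) \<le> 3 * exp (max l0 l1) + 2"
proof (cases "F = {}")
  case False
  then obtain x where x: "x \<in> U"
    using F by (auto simp: stop_words_meeting_def)
  define h where "h = exp (- max l0 l1) * r"
  have h: "h > 0"
    using assms by (simp add: h_def)
  \<comment> \<open>Left ends more than \<open>h\<close> apart fall into different cells of the grid
    of mesh \<open>h\<close>, so counting cells counts words.\<close>
  define \<phi> where "\<phi> = (\<lambda>(n, v). \<lfloor>left l0 l1 v n / h\<rfloor>)"
  \<comment> \<open>Points of \<open>U\<close> are within \<open>r\<close> of \<open>x\<close> and
    stopped intervals have length at most \<open>r\<close>, so their left ends lie between x - 2r
    and x + r.\<close>
  define a where "a = (x - 2 * r) / h"
  define b where "b = (x + r) / h"
  have inj: "inj_on \<phi> F"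
  proof (rule inj_onI, rule ccontr)
    fix y z assume yz: "y \<in> F" "z \<in> F" "\<phi> y = \<phi> z" "y \<noteq> z"
    obtain n v m w where [simp]: "y = (n, v)" "z = (m, w)" by fastforce
    have "h < \<bar>left l0 l1 v n - left l0 l1 w m\<bar>"
      unfolding h_def using yz F by (intro stop_words_separated) (auto simp: stop_words_meeting_def)
    then have "1 < \<bar>left l0 l1 v n / h - left l0 l1 w m / h\<bar>"
      using h by (simp add: diff_divide_distrib[symmetric])
    then show False
      using yz by (simp add: \<phi>_def) linarith
  qed
  have "\<phi> ` F \<subseteq> {\<lfloor>a\<rfloor>..\<lfloor>b\<rfloor>}"
  proof clarify
    fix n v assume "(n, v) \<in> F"
    then have "(n, v) \<in> stop_words_meeting U r"
      using F by blast
    then obtain y where y: "(n, v) \<in> stop_words r" "y \<in> U" "left l0 l1 v n \<le> y"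
      "y \<le> left l0 l1 v n + len l0 l1 v n"
      unfolding stop_words_meeting_def by auto
    have "\<bar>x - y\<bar> \<le> r"
      using diameter_bounded_bound[OF assms(1) x y(2)] assms(2) by (simp add: dist_real_def)
    then have "x - 2 * r \<le> left l0 l1 v n" "left l0 l1 v n \<le> x + r"
      using y stop_words_len[OF y(1)] by auto
    then have "a \<le> left l0 l1 v n / h" "left l0 l1 v n / h \<le> b"
      using h by (auto simp: a_def b_def divide_right_mono)
    then show "\<phi> (n, v) \<in> {\<lfloor>a\<rfloor>..\<lfloor>b\<rfloor>}"
      by (simp add: \<phi>_def floor_mono)
  qed
  then have "card (\<phi> ` F) \<le> card {\<lfloor>a\<rfloor>..\<lfloor>b\<rfloor>}"
    by (rule card_mono[rotated]) simp
  then have "card F \<le> nat (\<lfloor>b\<rfloor> - \<lfloor>a\<rfloor> + 1)"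
    using card_image[OF inj] by simp
  moreover have "b - a = 3 * exp (max l0 l1)"
    using assms(3) by (simp add: a_def b_def h_def exp_minus field_simps)
  moreover have "0 < b - a"
    unfolding calculation(2) by simp
  ultimately show ?thesis
    by linarith
qed simp

lemma exists_stop_word:
  assumes "\<omega> \<in> binary_seqs" "0 < r" "r < 1"
  obtains n where "(n, restrict \<omega> {1..n}) \<in> stop_words r"
proof -
  have "(\<lambda>n. exp (- (min l0 l1 * real n))) \<longlonglongrightarrow> 0"
    using l0 l1 by real_asymp
  then have "\<exists>n. exp (- (min l0 l1 * real n)) < r"
    using order_tendstoD(2)[OF _ \<open>0 < r\<close>] eventually_happens'[OF sequentially_bot] by blast
  then have "\<exists>n. len l0 l1 \<omega> n \<le> r"
    using len_le[of \<omega>] by (auto intro: le_less_trans less_imp_le)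
  then obtain n where n: "len l0 l1 \<omega> n \<le> r" "\<And>m. m < n \<Longrightarrow> \<not> len l0 l1 \<omega> m \<le> r"
    unfolding exists_least_iff[of "\<lambda>n. len l0 l1 \<omega> n \<le> r"] by blast
  \<comment> \<open>The empty word has length 1, so r < 1 makes the stopping time positive and n - 1
    a genuine predecessor.\<close>
  have "0 < n"
    using n(1) \<open>r < 1\<close> by (cases n) auto
  have "len l0 l1 (restrict \<omega> {1..n}) m = len l0 l1 \<omega> m" if "m \<le> n" for m
    using that by (intro len_cong) auto
  then have "(n, restrict \<omega> {1..n}) \<in> stop_words r"
    using n(1) n(2)[of "n - 1"] \<open>0 < n\<close> restrict_binary[OF assms(1)]
    by (auto simp: stop_words_def not_le simp del: One_nat_def)
  then show thesis
    by (rule that)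
qed

end

section \<open>The mass distribution argument\<close>

lemma sum_le_finite_cover:
  fixes f :: "'a \<Rightarrow> real"
  assumes "finite J" "finite F" "F \<subseteq> (\<Union>i\<in>J. A i)"
    and "\<And>i F'. i \<in> J \<Longrightarrow> finite F' \<Longrightarrow> F' \<subseteq> A i \<Longrightarrow> sum f F' \<le> b i"
  shows "sum f F \<le> sum b J"
  using assms
proof (induction J arbitrary: F rule: finite_induct)
  case (insert i J)
  have "sum f F = sum f (F \<inter> A i) + sum f (F - A i)"
    using insert.prems by (simp add: sum.Int_Diff)
  also have "\<dots> \<le> b i + sum b J"
    using insert.prems by (intro add_mono insert.IH) auto
  finally show ?case
    using insert by simp
qed simp

text \<open>Choosing one index for each element of the finite set \<open>F\<close> leaves finitely
  many indices, so bounded partial sums of \<open>b\<close> suffice for a countable cover.\<close>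

lemma sum_le_cover:
  fixes f :: "'a \<Rightarrow> real"
  assumes "finite F" "F \<subseteq> (\<Union>i. A i)"
    and "\<And>i F'. finite F' \<Longrightarrow> F' \<subseteq> A i \<Longrightarrow> sum f F' \<le> b i"
    and "\<And>J. finite J \<Longrightarrow> sum b J \<le> B"
  shows "sum f F \<le> B"
proof -
  obtain \<iota> where "\<And>x. x \<in> F \<Longrightarrow> x \<in> A (\<iota> x)"
    using assms(2) by (metis UN_iff subsetD)
  then have "sum f F \<le> sum b (\<iota> ` F)"
    using assms by (intro sum_le_finite_cover[where A = A]) auto
  also have "\<dots> \<le> B"
    using assms by blast
  finally show ?thesis .
qed

text \<open>The constant controls the number of ones, the indicator of state 1 the number of pairs.
  Both signs occur because \<open>mart_deviation\<close> is one-sided.\<close>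

definition deviation_tests :: "(nat \<Rightarrow> real) set" where
  "deviation_tests =
     {\<lambda>_. 1, \<lambda>_. -1, \<lambda>a. if a = 0 then 0 else 1, \<lambda>a. if a = 0 then 0 else -1}"

text \<open>Positive masses rule out transitions of probability 0, which exist when q = 0, and make
  \<open>ln (mass p q \<omega> n)\<close> meaningful.\<close>

definition typical :: "real \<Rightarrow> real \<Rightarrow> nat \<Rightarrow> (nat \<Rightarrow> nat) \<Rightarrow> bool" where
  "typical p q N \<omega> \<longleftrightarrow> (\<forall>n. mass p q \<omega> n > 0) \<and>
     (\<forall>n\<ge>N. \<forall>c\<in>deviation_tests. mart p q c \<omega> n < real n powr (3/4))"

lemma mart_uminus: "mart p q (\<lambda>a. - c a) \<omega> n = - mart p q c \<omega> n"
  by (simp add: mart_def sum_negf)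

lemma typical_mart:
  assumes "typical p q N \<omega>" "n \<ge> N" "c \<in> deviation_tests"
  shows "\<bar>mart p q c \<omega> n\<bar> \<le> real n powr (3/4)"
proof -
  have "(\<lambda>a. - c a) \<in> deviation_tests"
    using assms(3) by (auto simp: deviation_tests_def fun_eq_iff)
  then have "mart p q c \<omega> n < real n powr (3/4)" "mart p q (\<lambda>a. - c a) \<omega> n < real n powr (3/4)"
    using assms by (auto simp: typical_def)
  then show ?thesis
    by (simp add: mart_uminus)
qed

lemma summable_deviation: "summable (\<lambda>n. exp (- sqrt (real n) / 4))"
proof (rule summable_comparison_test_bigo)
  show "summable (\<lambda>n. norm (real n powr -2))"
    by (simp add: summable_real_powr_iff)
  show "(\<lambda>n. exp (- sqrt (real n) / 4)) \<in> O(\<lambda>n. real n powr -2)"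
    by real_asymp
qed

context ifs_pair
begin

text \<open>If the measure were 0, there would be a cheap cover. The stopped words meeting its sets,
  the deviating words and the null words together have mass at most 1/2, so some sequence avoids
  them all. It is typical, hence in \<open>E\<close>, and its projection lies in a covering set; its
  prefix stopped at the scale of that set is then one of the avoided words.\<close>

lemma hausdorff_measure_projection_pos:
  assumes pq: "0 \<le> p" "p \<le> 1" "0 \<le> q" "q \<le> 1" and "0 \<le> t"
    and E: "\<And>N \<omega>. \<omega> \<in> binary_seqs \<Longrightarrow> typical p q N \<omega> \<Longrightarrow> \<omega> \<in> E"
    and mass_le: "\<And>N. \<exists>n0. \<forall>n\<ge>n0. \<forall>\<omega>\<in>binary_seqs. typical p q N \<omega> \<longrightarrow>
                   mass p q \<omega> n \<le> len l0 l1 \<omega> n powr t"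
  shows "hausdorff_measure t (natural_proj l0 l1 ` E) \<noteq> 0"
proof
  assume zero: "hausdorff_measure t (natural_proj l0 l1 ` E) = 0"
  define f where "f = (\<lambda>(n, v). mass p q v n)"
  have f_nonneg: "0 \<le> f x" for x
    using mass_nonneg[OF pq] by (simp add: f_def split: prod.split)

  let ?g = "\<lambda>n. exp (- sqrt (real n) / 4)"
  \<comment> \<open>Each of the four deviation tests has the budget 1/16; N > 0 is required by
    \<open>mart_deviation\<close>.\<close>
  have "\<forall>\<^sub>F n in sequentially. suminf (\<lambda>i. ?g (i + n)) < 1/16"
    using suminf_exist_split2[OF summable_deviation] by (intro order_tendstoD(2)) auto
  then have "\<forall>\<^sub>F n in sequentially. suminf (\<lambda>i. ?g (i + n)) < 1/16 \<and> n > 0"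
    using eventually_gt_at_top by (rule eventually_conj)
  then obtain N where N: "suminf (\<lambda>i. ?g (i + N)) < 1/16" "N > 0"
    using eventually_happens'[OF sequentially_bot] by blast
  define D where "D = (\<lambda>c. {(n, v). v \<in> words n \<and> N \<le> n \<and> real n powr (3/4) \<le> mart p q c v n})"
  have sum_D: "sum f F \<le> 1/16" if "c \<in> deviation_tests" "finite F" "F \<subseteq> D c" for c F
  proof (rule sum_le_cover)
    let ?A = "\<lambda>i. Pair (i + N) ` {v. v \<in> words (i + N) \<and> real (i + N) powr (3/4) \<le> mart p q c v (i + N)}"
    show "F \<subseteq> (\<Union>i. ?A i)"
    proof
      fix x assume "x \<in> F"
      then obtain n v where "x = (n, v)" "v \<in> words n" "N \<le> n" "real n powr (3/4) \<le> mart p q c v n"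
        using \<open>F \<subseteq> D c\<close> unfolding D_def by blast
      then have "x \<in> ?A (n - N)"
        by simp
      then show "x \<in> (\<Union>i. ?A i)"
        by blast
    qed
    show "sum f F' \<le> ?g (i + N)" if "finite F'" "F' \<subseteq> ?A i" for i F'
    proof -
      have "sum f F' \<le> sum f (?A i)"
        using that f_nonneg by (intro sum_mono2 finite_imageI) auto
      also have "\<dots> = (\<Sum>u | u \<in> words (i + N) \<and> real (i + N) powr (3/4) \<le> mart p q c u (i + N).
                       mass p q u (i + N))"
        by (subst sum.reindex) (auto simp: inj_on_def f_def)
      also have "\<dots> \<le> ?g (i + N)"
        using \<open>c \<in> deviation_tests\<close> N(2)
        by (intro mart_deviation[OF pq]) (auto simp: deviation_tests_def)
      finally show ?thesis .
    qed
    show "(\<Sum>i\<in>J. ?g (i + N)) \<le> 1/16" if "finite J" for J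
    proof -
      have "(\<Sum>i\<in>J. ?g (i + N)) \<le> suminf (\<lambda>i. ?g (i + N))"
        using that summable_ignore_initial_segment[OF summable_deviation, of N]
        by (intro sum_le_suminf) auto
      then show ?thesis
        using N by simp
    qed
  qed fact

  obtain n0 where n0: "\<And>n \<omega>. n \<ge> n0 \<Longrightarrow> \<omega> \<in> binary_seqs \<Longrightarrow> typical p q N \<omega> \<Longrightarrow>
      mass p q \<omega> n \<le> len l0 l1 \<omega> n powr t"
    using mass_le by blast
  \<comment> \<open>A basic interval of length at most \<delta> belongs to a word longer than
    \<open>n0\<close>, so the mass estimate holds at every stopping time in use.\<close>
  define \<delta> where "\<delta> = exp (- (max l0 l1 * (n0 + 1)))"
  have \<delta>: "0 < \<delta>" "\<delta> < 1"
    using l0 by (auto simp: \<delta>_def)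
  define C where "C = 3 * exp (max l0 l1) + 2"
  have C: "C > 0"
    by (auto simp: C_def intro: add_pos_pos)
  \<comment> \<open>\<open>C\<close> bounds the number of stopped words per covering set. The cover
    costs less than \<open>e\<close> and the enlarged radii add at most another \<open>e\<close>, so
    the stopped words weigh at most C * 2e = 1/4.\<close>
  define e where "e = 1 / (8 * C)"
  have e: "e > 0"
    using C by (simp add: e_def)
  obtain U :: "nat \<Rightarrow> real set" where U: "natural_proj l0 l1 ` E \<subseteq> (\<Union>i. U i)"
    "\<And>i. bounded (U i)" "\<And>i. diameter (U i) \<le> \<delta>" "(\<Sum>i. diam_power t (U i)) < ennreal e"
    using hausdorff_measure_eq_0D[OF zero \<delta>(1) e] by metis
  have "\<exists>r. U i \<noteq> {} \<longrightarrow> 0 < r \<and> r \<le> \<delta> \<and> diameter (U i) \<le> r \<and>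
      ennreal (r powr t) \<le> diam_power t (U i) + ennreal (e * (1/2) ^ Suc i)" for i
    using diam_power_radius[OF U(2,3) \<delta>(1) \<open>0 \<le> t\<close>, of "e * (1/2) ^ Suc i" i] e
    by (metis mult_pos_pos zero_less_divide_1_iff zero_less_numeral zero_less_power)
  then obtain r where r: "\<And>i. U i \<noteq> {} \<Longrightarrow> 0 < r i" "\<And>i. U i \<noteq> {} \<Longrightarrow> r i \<le> \<delta>"
    "\<And>i. U i \<noteq> {} \<Longrightarrow> diameter (U i) \<le> r i"
    "\<And>i. U i \<noteq> {} \<Longrightarrow> ennreal (r i powr t) \<le> diam_power t (U i) + ennreal (e * (1/2) ^ Suc i)"
    by metis
  \<comment> \<open>Only words obeying the mass estimate enter \<open>H\<close>, which bounds their
    masses by \<open>r i powr t\<close> directly; the typical sequence found below has such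
    prefixes.\<close>
  define H where "H = (\<lambda>i. if U i = {} then {} else
      {(n, v) \<in> stop_words_meeting (U i) (r i). mass p q v n \<le> len l0 l1 v n powr t})"
  define b where "b = (\<lambda>i. if U i = {} then 0 else r i powr t)"
  have sum_H_le: "sum f F \<le> C * b i" if "finite F" "F \<subseteq> H i" for F i
  proof (cases "U i = {}")
    case True
    then show ?thesis
      using that by (simp add: H_def b_def)
  next
    case False
    have "f x \<le> r i powr t" if "x \<in> F" for x
    proof -
      have "x \<in> H i"
        using that \<open>F \<subseteq> H i\<close> by blast
      then obtain n v where x: "x = (n, v)" "(n, v) \<in> stop_words (r i)" "mass p q v n \<le> len l0 l1 v n powr t"
        using False by (auto simp: H_def stop_words_meeting_def)
      have "len l0 l1 v n powr t \<le> r i powr t"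
        using stop_words_len(2)[OF x(2)] len_pos[of l0 l1 v n] \<open>0 \<le> t\<close> by (intro powr_mono2) auto
      then show ?thesis
        using x by (simp add: f_def)
    qed
    then have "sum f F \<le> card F * (r i powr t)"
      using sum_bounded_above[of F f] by simp
    also have "\<dots> \<le> C * (r i powr t)"
      using card_stop_words_meeting[OF U(2) r(3,1), of i F] that False
      by (intro mult_right_mono) (auto simp: C_def H_def)
    finally show ?thesis
      using False by (simp add: b_def)
  qed
  have sum_b: "(\<Sum>i\<in>J. C * b i) \<le> 1/4" if "finite J" for J
  proof -
    have "ennreal (\<Sum>i\<in>J. b i) = (\<Sum>i\<in>J. ennreal (b i))"
      by (simp add: b_def)
    also have "\<dots> \<le> (\<Sum>i\<in>J. diam_power t (U i) + ennreal (e * (1/2) ^ Suc i))"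
      using r(4) by (intro sum_mono) (auto simp: b_def)
    also have "\<dots> = (\<Sum>i\<in>J. diam_power t (U i)) + (\<Sum>i\<in>J. ennreal (e * (1/2) ^ Suc i))"
      by (rule sum.distrib)
    also have "\<dots> \<le> ennreal e + ennreal e"
    proof (rule add_mono)
      have "(\<Sum>i\<in>J. diam_power t (U i)) \<le> (\<Sum>i. diam_power t (U i))"
        using that by (intro sum_le_suminf) auto
      then show "(\<Sum>i\<in>J. diam_power t (U i)) \<le> ennreal e"
        using U(4) by simp
      have sums: "(\<lambda>i. e * (1/2) ^ Suc i) sums (e * 1)"
        by (intro sums_mult power_half_series)
      have "(\<Sum>i\<in>J. e * (1/2) ^ Suc i) \<le> (\<Sum>i. e * (1/2) ^ Suc i)"
        using that sums e by (intro sum_le_suminf) (auto simp: sums_iff)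
      then have "(\<Sum>i\<in>J. e * (1/2) ^ Suc i) \<le> e"
        using sums by (simp only: sums_iff)
      then have "ennreal (\<Sum>i\<in>J. e * (1/2) ^ Suc i) \<le> ennreal e"
        by (rule ennreal_leI)
      then show "(\<Sum>i\<in>J. ennreal (e * (1/2) ^ Suc i)) \<le> ennreal e"
        using e by simp
    qed
    also have "\<dots> = ennreal (2 * e)"
      using e by (simp flip: ennreal_plus)
    finally have "(\<Sum>i\<in>J. b i) \<le> 2 * e"
      using e by simp
    then have "C * (\<Sum>i\<in>J. b i) \<le> C * (2 * e)"
      using C by simp
    then show ?thesis
      using C by (simp add: e_def sum_distrib_left)
  qed
  define Z where "Z = {(n, v). v \<in> words n \<and> mass p q v n = 0}"
  define G where "G = (\<Union>c\<in>deviation_tests. D c) \<union> Z \<union> (\<Union>i. H i)"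
  have "\<exists>u\<in>words M. \<forall>n\<le>M. (n, restrict u {1..n}) \<notin> G" for M
  proof (rule exists_avoiding_word[OF pq])
    show "G \<subseteq> Sigma UNIV words"
      by (auto simp: G_def D_def Z_def H_def stop_words_meeting_def stop_words_def split: if_split_asm)
    show "(\<Sum>(n, v)\<in>F. mass p q v n) \<le> 1/2" if F: "finite F" "F \<subseteq> G" for F
    proof -
      let ?D = "\<Union>c\<in>deviation_tests. D c" and ?H = "\<Union>i. H i"
      have "F = F \<inter> ?D \<union> (F - ?D)" "F - ?D = (F - ?D) \<inter> Z \<union> (F - ?D - Z)"
        by blast+
      then have "sum f F = sum f (F \<inter> ?D) + (sum f ((F - ?D) \<inter> Z) + sum f (F - ?D - Z))"
        using F(1) by (metis finite_Diff sum.Int_Diff)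
      also have "sum f (F \<inter> ?D) \<le> (\<Sum>c\<in>deviation_tests. 1/16)"
        using F(1) sum_D by (intro sum_le_finite_cover[where A = D]) (auto simp: deviation_tests_def)
      also have "\<dots> \<le> 1/4"
        by (auto simp: deviation_tests_def card_insert_if)
      also have "sum f ((F - ?D) \<inter> Z) = 0"
        by (rule sum.neutral) (auto simp: Z_def f_def)
      also have "sum f (F - ?D - Z) \<le> 1/4"
      proof (rule sum_le_cover)
        show "F - ?D - Z \<subseteq> ?H"
          using F(2) by (auto simp: G_def)
      qed (use F sum_H_le sum_b in auto)
      finally show ?thesis
        by (simp add: f_def)
    qed
  qed simp
  then obtain \<omega> where \<omega>: "\<omega> \<in> binary_seqs" "\<And>n. (n, restrict \<omega> {1..n}) \<notin> G"
    using koenig_words[of G] by metis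
  have mass_eq: "mass p q (restrict \<omega> {1..n}) n = mass p q \<omega> n" for n
    by (rule mass_cong) auto
  have mart_eq: "mart p q c (restrict \<omega> {1..n}) n = mart p q c \<omega> n" for c n
    by (rule mart_cong) auto
  have len_eq: "len l0 l1 (restrict \<omega> {1..n}) n = len l0 l1 \<omega> n" for n
    by (rule len_cong) auto
  have left_eq: "left l0 l1 (restrict \<omega> {1..n}) n = left l0 l1 \<omega> n" for n
    by (rule left_cong) auto
  have is_typical: "typical p q N \<omega>"
    unfolding typical_def
  proof (intro conjI allI impI ballI)
    fix n
    have "(n, restrict \<omega> {1..n}) \<notin> Z"
      using \<omega>(2) by (simp add: G_def)
    then have "mass p q \<omega> n \<noteq> 0"
      using restrict_binary[OF \<omega>(1), of n] by (simp add: Z_def mass_eq del: One_nat_def)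
    then show "mass p q \<omega> n > 0"
      using mass_nonneg[OF pq, of \<omega> n] by simp
  next
    fix n c assume "N \<le> n" "c \<in> deviation_tests"
    then have "(n, restrict \<omega> {1..n}) \<notin> D c"
      using \<omega>(2) by (auto simp: G_def)
    then show "mart p q c \<omega> n < real n powr (3/4)"
      using restrict_binary[OF \<omega>(1), of n] \<open>N \<le> n\<close> by (simp add: D_def mart_eq del: One_nat_def)
  qed
  then have "\<omega> \<in> E"
    using E \<omega>(1) by blast
  then obtain i where i: "natural_proj l0 l1 \<omega> \<in> U i"
    using U(1) by blast
  then have Ui: "U i \<noteq> {}"
    by blast
  obtain n where n: "(n, restrict \<omega> {1..n}) \<in> stop_words (r i)"
    using exists_stop_word[OF \<omega>(1), of "r i"] r[OF Ui] \<delta> by force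
  have "exp (- (max l0 l1 * n)) \<le> exp (- (max l0 l1 * (n0 + 1)))"
    using len_ge[of n \<omega>] stop_words_len(2)[OF n] r(2)[OF Ui] unfolding len_eq \<delta>_def by linarith
  then have "max l0 l1 * (n0 + 1) \<le> max l0 l1 * n"
    by simp
  then have "real (n0 + 1) \<le> real n"
    using l0 by (subst (asm) mult_le_cancel_left_pos) auto
  then have "n0 \<le> n"
    by simp
  then have "mass p q \<omega> n \<le> len l0 l1 \<omega> n powr t"
    using n0 \<omega>(1) is_typical by blast
  moreover have "natural_proj l0 l1 \<omega> \<in> {left l0 l1 \<omega> n..left l0 l1 \<omega> n + len l0 l1 \<omega> n} \<inter> U i"
    using natural_proj_bounds i by blast
  ultimately have "(n, restrict \<omega> {1..n}) \<in> H i"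
    using n Ui by (auto simp: H_def stop_words_meeting_def mass_eq len_eq left_eq
        simp del: One_nat_def)
  then show False
    using \<omega>(2) by (auto simp: G_def)
qed

end

section \<open>Balanced chains\<close>

text \<open>Otherwise the sequence would fall by more than \<eta> at every step from
  \<open>N\<close> on and become unbounded. It is meant for the density of ones along powers of
  2.\<close>

lemma bounded_increments:
  fixes a :: "nat \<Rightarrow> real"
  assumes "\<And>j. \<bar>a j\<bar> \<le> B" "\<eta> > 0"
  shows "\<exists>j\<ge>N. - \<eta> \<le> a (Suc j) - a j"
proof (rule ccontr)
  assume "\<not> ?thesis"
  then have step: "a (Suc j) < a j - \<eta>" if "j \<ge> N" for j
    using that by force
  have decay: "a (N + k) \<le> a N - k * \<eta>" for k
  proof (induction k)
    case (Suc k)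
    then show ?case
      using step[of "N + k"] by (simp add: algebra_simps)
  qed simp
  obtain k :: nat where "2 * B < k * \<eta>"
    using reals_Archimedean3[OF \<open>\<eta> > 0\<close>] by blast
  then show False
    using decay[of k] assms(1)[of N] assms(1)[of "N + k"] by linarith
qed

lemma ones_bounds:
  assumes "\<And>k. 1 \<le> k \<Longrightarrow> k \<le> n \<Longrightarrow> \<omega> k = 0 \<or> \<omega> k = 1"
  shows "0 \<le> ones \<omega> n" "ones \<omega> n \<le> n"
proof -
  show "0 \<le> ones \<omega> n"
    by (simp add: ones_def sum_nonneg)
  have "(\<Sum>k=1..n. real (\<omega> k)) \<le> (\<Sum>k=1..n. 1)"
    using assms by (intro sum_mono) force
  then show "ones \<omega> n \<le> n"
    by (simp add: ones_def)
qed

lemma mart_trivial_bound: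
  assumes "0 \<le> p" "p \<le> 1" "0 \<le> q" "q \<le> 1" "\<And>a. \<bar>c a\<bar> \<le> 1"
    and "\<And>k. 1 \<le> k \<Longrightarrow> k \<le> n \<Longrightarrow> \<omega> k = 0 \<or> \<omega> k = 1"
  shows "\<bar>mart p q c \<omega> n\<bar> \<le> n"
proof -
  have "\<bar>mart p q c \<omega> n\<bar> \<le> (\<Sum>k=1..n. 1)"
    unfolding mart_def
  proof (rule order_trans[OF sum_abs sum_mono])
    fix k assume "k \<in> {1..n}"
    then have "\<bar>real (\<omega> k) - tr p q (parent \<omega> k) 1\<bar> \<le> 1"
      using assms(1-4) assms(6)[of k] by (auto simp: tr_def)
    then show "\<bar>c (parent \<omega> k) * (real (\<omega> k) - tr p q (parent \<omega> k) 1)\<bar> \<le> 1"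
      using assms(5) by (simp add: abs_mult mult_le_one)
  qed
  then show ?thesis by simp
qed

text \<open>n^(3/4) is below \<eta> n for large \<open>n\<close>, and \<open>C\<close> absorbs the
  remaining \<open>n\<close> by the trivial bound. It does not depend on \<omega>, as the uniform
  mass estimate demands.\<close>

lemma typical_mart_sublinear:
  fixes p q \<eta> :: real
  assumes pq: "0 \<le> p" "p \<le> 1" "0 \<le> q" "q \<le> 1" and "\<eta> > 0"
  obtains C where "0 \<le> C" "\<And>\<omega> c n. \<omega> \<in> binary_seqs \<Longrightarrow> typical p q N \<omega> \<Longrightarrow>
    c \<in> deviation_tests \<Longrightarrow> \<bar>mart p q c \<omega> n\<bar> \<le> \<eta> * n + C"
proof -
  have "\<forall>\<^sub>F n in sequentially. real n powr (3/4) \<le> \<eta> * real n"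
    using \<open>\<eta> > 0\<close> by real_asymp
  then obtain M where M: "\<And>n. n \<ge> M \<Longrightarrow> real n powr (3/4) \<le> \<eta> * real n"
    by (auto simp: eventually_sequentially)
  show thesis
  proof (rule that[of "real (max M N)"])
    fix \<omega> n and c :: "nat \<Rightarrow> real"
    assume \<omega>: "\<omega> \<in> binary_seqs" "typical p q N \<omega>" and c: "c \<in> deviation_tests"
    show "\<bar>mart p q c \<omega> n\<bar> \<le> \<eta> * n + real (max M N)"
    proof (cases "max M N \<le> n")
      case True
      then show ?thesis
        using typical_mart[OF \<omega>(2) _ c, of n] M[of n] by (simp add: max_def split: if_splits)
    next
      case False
      have "\<bar>mart p q c \<omega> n\<bar> \<le> n"
        using c binary_cases[OF \<omega>(1)] by (intro mart_trivial_bound[OF pq]) (auto simp: deviation_tests_def)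
      then show ?thesis
        using False \<open>\<eta> > 0\<close> by (smt (verit) mult_nonneg_nonneg of_nat_0_le_iff of_nat_le_iff)
    qed
  qed simp
qed

text \<open>\<open>m\<close> is the limiting density of ones, the solution of m = p + (q - p) m / 2.
  By \<open>ones_mart\<close> the deviation from it is contracted by |q - p| < 1 at each halving, up
  to the martingale and the rounding of \<open>n div 2\<close>.\<close>

lemma typical_frequencies:
  fixes p q m \<eta> :: real
  assumes pq: "0 < p" "p < 1" "0 \<le> q" "q < 1" and "\<eta> > 0"
    and m: "m * (2 + p - q) = 2 * p"
  obtains C where "0 \<le> C" "\<And>\<omega> n. \<omega> \<in> binary_seqs \<Longrightarrow> typical p q N \<omega> \<Longrightarrow>
    \<bar>ones \<omega> n - m * n\<bar> \<le> \<eta> * n + C"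
    "\<And>\<omega> n. \<omega> \<in> binary_seqs \<Longrightarrow> typical p q N \<omega> \<Longrightarrow> \<bar>ones \<omega> (n div 2) - m * n / 2\<bar> \<le> \<eta> * n + C"
    "\<And>\<omega> n. \<omega> \<in> binary_seqs \<Longrightarrow> typical p q N \<omega> \<Longrightarrow> \<bar>pairs \<omega> n - q * m * n / 2\<bar> \<le> \<eta> * n + C"
proof -
  have pq': "0 \<le> p" "p \<le> 1" "0 \<le> q" "q \<le> 1"
    using pq by auto
  have \<eta>4: "\<eta> / 4 > 0"
    using \<open>\<eta> > 0\<close> by simp
  obtain C where C: "0 \<le> C" "\<And>\<omega> c n. \<omega> \<in> binary_seqs \<Longrightarrow> typical p q N \<omega> \<Longrightarrow>
    c \<in> deviation_tests \<Longrightarrow> \<bar>mart p q c \<omega> n\<bar> \<le> \<eta> / 4 * n + C"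
    using typical_mart_sublinear[OF pq' \<eta>4, where N = N] by blast
  define r where "r = \<bar>q - p\<bar>"
  have r: "0 \<le> r" "r < 1"
    using pq by (auto simp: r_def)
  have m_eq: "m = 2 * p / (2 + p - q)"
    using m pq by (simp add: field_simps)
  then have m_nonneg: "0 \<le> m"
    using pq by simp
  define C1 where "C1 = (C + r * m) / (1 - r)"
  have C1: "0 \<le> C1"
    using C(1) r m_nonneg by (simp add: C1_def)
  have half: "\<bar>m * real (n div 2) - m * n / 2\<bar> \<le> m" for n
  proof -
    have "\<bar>real (n div 2) - n / 2\<bar> \<le> 1"
      by linarith
    then have "m * \<bar>real (n div 2) - n / 2\<bar> \<le> m * 1"
      using m_nonneg by (rule mult_left_mono)
    moreover have "m * real (n div 2) - m * n / 2 = m * (real (n div 2) - n / 2)"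
      by (simp add: right_diff_distrib)
    ultimately show ?thesis
      using m_nonneg by (simp add: abs_mult)
  qed
  have ones: "\<bar>ones \<omega> n - m * n\<bar> \<le> \<eta> / 2 * n + C1" if \<omega>: "\<omega> \<in> binary_seqs" "typical p q N \<omega>" for \<omega> n
  proof -
    have "\<bar>ones \<omega> n - m * n\<bar> \<le> 2 * (\<eta> / 4) * n + (C + r * m) / (1 - r)"
    proof (rule rate_recursion)
      fix n :: nat
      have "ones \<omega> n = mart p q (\<lambda>_. 1) \<omega> n + p * n + (q - p) * ones \<omega> (n div 2)"
        using binary_cases[OF \<omega>(1)] by (intro ones_mart)
      \<comment> \<open>The fixed-point equation for \<open>m\<close>, multiplied by
        \<open>n\<close>.\<close>
      moreover have "m * n = p * n + (q - p) * (m * n / 2)"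
        using arg_cong[OF m, of "\<lambda>x. x * n / 2"] by (simp add: field_simps)
      moreover have "(q - p) * (ones \<omega> (n div 2) - m * real (n div 2)) + (q - p) * (m * real (n div 2) - m * n / 2)
          = (q - p) * ones \<omega> (n div 2) - (q - p) * (m * n / 2)"
        by (simp add: algebra_simps)
      ultimately have "ones \<omega> n - m * n = mart p q (\<lambda>_. 1) \<omega> n
          + ((q - p) * (ones \<omega> (n div 2) - m * real (n div 2)) + (q - p) * (m * real (n div 2) - m * n / 2))"
        by linarith
      then have "\<bar>ones \<omega> n - m * n\<bar> \<le> \<bar>mart p q (\<lambda>_. 1) \<omega> n\<bar>
          + (r * \<bar>ones \<omega> (n div 2) - m * real (n div 2)\<bar> + r * \<bar>m * real (n div 2) - m * n / 2\<bar>)"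
        unfolding r_def abs_mult[symmetric] by linarith
      also have "\<dots> \<le> (\<eta> / 4 * n + C) + (r * \<bar>ones \<omega> (n div 2) - m * real (n div 2)\<bar> + r * m)"
        using C(2)[OF \<omega>] half r
        by (intro add_mono mult_left_mono order_refl) (auto simp: deviation_tests_def)
      finally show "\<bar>ones \<omega> n - m * n\<bar> \<le>
          r * \<bar>ones \<omega> (n div 2) - m * real (n div 2)\<bar> + \<eta> / 4 * n + (C + r * m)"
        by simp
    qed (use r \<open>\<eta> > 0\<close> C(1) m_nonneg in \<open>auto simp: ones_def\<close>)
    then show ?thesis
      by (simp add: C1_def)
  qed
  have ones_half: "\<bar>ones \<omega> (n div 2) - m * n / 2\<bar> \<le> \<eta> / 2 * n + (C1 + m)"
    if \<omega>: "\<omega> \<in> binary_seqs" "typical p q N \<omega>" for \<omega> n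
  proof -
    have "\<eta> / 2 * real (n div 2) \<le> \<eta> / 2 * n"
      using \<open>\<eta> > 0\<close> by (intro mult_left_mono) auto
    then show ?thesis
      using ones[OF \<omega>, of "n div 2"] half[of n] by linarith
  qed
  show thesis
  proof (rule that[of "C + C1 + m"])
    show "0 \<le> C + C1 + m"
      using C(1) C1 m_nonneg by simp
    fix \<omega> and n :: nat
    assume \<omega>: "\<omega> \<in> binary_seqs" "typical p q N \<omega>"
    have n: "\<eta> / 2 * n \<le> \<eta> * n" "\<eta> / 4 * n + \<eta> / 2 * n \<le> \<eta> * n"
      using \<open>\<eta> > 0\<close> by simp_all
    show "\<bar>ones \<omega> n - m * n\<bar> \<le> \<eta> * n + (C + C1 + m)"
      using ones[OF \<omega>, of n] n C(1) m_nonneg by linarith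
    show "\<bar>ones \<omega> (n div 2) - m * n / 2\<bar> \<le> \<eta> * n + (C + C1 + m)"
      using ones_half[OF \<omega>, of n] n C(1) by linarith
    define g :: "nat \<Rightarrow> real" where "g = (\<lambda>a. if a = 0 then 0 else 1)"
    have "pairs \<omega> n = mart p q g \<omega> n + q * ones \<omega> (n div 2)"
      unfolding g_def using binary_cases[OF \<omega>(1)] by (intro pairs_mart)
    then have "\<bar>pairs \<omega> n - q * m * n / 2\<bar> \<le> \<bar>mart p q g \<omega> n\<bar> + \<bar>q * (ones \<omega> (n div 2) - m * n / 2)\<bar>"
      by (simp add: algebra_simps)
    also have "\<dots> \<le> (\<eta> / 4 * n + C) + 1 * (\<eta> / 2 * n + (C1 + m))"
      unfolding abs_mult using C(2)[OF \<omega>, of g] ones_half[OF \<omega>, of n] pq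
      by (intro add_mono mult_mono) (auto simp: g_def deviation_tests_def)
    also have "\<dots> \<le> \<eta> * n + (C + C1 + m)"
      using n(2) by simp
    finally show "\<bar>pairs \<omega> n - q * m * n / 2\<bar> \<le> \<eta> * n + (C + C1 + m)" .
  qed
qed

text \<open>The balance condition says that \<open>tr p q a b = exp (\<beta> * a * b - s * rate b) * \<psi> b / (\<psi> a)\<^sup>2\<close> for a
  positive function \<open>\<psi>\<close> on the states with \<open>(\<psi> 0)\<^sup>2 = exp (\<alpha> * \<beta>)\<close> and \<open>\<kappa> = ln (\<psi> 1 / \<psi> 0)\<close>.\<close>

lemma le_abs_mult:
  fixes a b c :: real
  assumes "\<bar>b\<bar> \<le> c"
  shows "a * b \<le> \<bar>a\<bar> * c"
proof -
  have "a * b \<le> \<bar>a\<bar> * \<bar>b\<bar>"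
    by (simp flip: abs_mult)
  also have "\<dots> \<le> \<bar>a\<bar> * c"
    using assms by (intro mult_left_mono) auto
  finally show ?thesis .
qed

locale balanced_chain = ifs_pair +
  fixes p q \<alpha> \<beta> \<kappa> s :: real
  assumes p: "0 < p" "p < 1" and q: "0 \<le> q" "q < 1"
    and balance: "\<And>a b. a \<in> {0, 1} \<Longrightarrow> b \<in> {0, 1} \<Longrightarrow> tr p q a b > 0 \<Longrightarrow>
      ln (tr p q a b) = - s * rate l0 l1 b + \<beta> * real (a * b) - \<alpha> * \<beta> / 2 + \<kappa> * (real b - 2 * real a)"
begin

lemma pq: "0 \<le> p" "p \<le> 1" "0 \<le> q" "q \<le> 1"
  using p q by auto

text \<open>The logarithm turns the product into a sum of \<open>balance\<close> terms, and
  \<open>sum_parent\<close> evaluates the parents in the \<kappa> terms. Positive mass ensures that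
  no transition of probability 0 occurs, on which \<open>balance\<close> says nothing.\<close>

lemma ln_mass:
  assumes \<omega>: "\<And>k. 1 \<le> k \<Longrightarrow> k \<le> n \<Longrightarrow> \<omega> k = 0 \<or> \<omega> k = 1" and pos: "mass p q \<omega> n > 0"
  shows "ln (mass p q \<omega> n) = s * ln (len l0 l1 \<omega> n) + \<beta> * (pairs \<omega> n - \<alpha> * n / 2)
           + \<kappa> * (ones \<omega> n - 2 * ones \<omega> (n div 2))"
proof -
  have tr_pos: "0 < tr p q (parent \<omega> k) (\<omega> k)" if "k \<in> {1..n}" for k
  proof -
    have "tr p q (parent \<omega> k) (\<omega> k) \<noteq> 0"
      using pos that unfolding mass_def by (metis finite_atLeastAtMost less_irrefl prod_zero)
    then show ?thesis
      using tr_nonneg[OF pq, of "parent \<omega> k" "\<omega> k"] by linarith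
  qed
  have "ln (mass p q \<omega> n) = (\<Sum>k=1..n. ln (tr p q (parent \<omega> k) (\<omega> k)))"
    unfolding mass_def by (rule ln_prod) (use tr_pos in \<open>force simp: less_le\<close>)+
  also have "\<dots> = (\<Sum>k=1..n. - s * rate l0 l1 (\<omega> k) + \<beta> * real (parent \<omega> k * \<omega> k) - \<alpha> * \<beta> / 2
                  + \<kappa> * (real (\<omega> k) - 2 * real (parent \<omega> k)))"
  proof (rule sum.cong)
    fix k assume k: "k \<in> {1..n}"
    then have "parent \<omega> k = 0 \<or> parent \<omega> k = 1" "\<omega> k = 0 \<or> \<omega> k = 1"
      using parent_le_1[of n \<omega> k] \<omega> by auto
    then show "ln (tr p q (parent \<omega> k) (\<omega> k)) = - s * rate l0 l1 (\<omega> k)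
        + \<beta> * real (parent \<omega> k * \<omega> k) - \<alpha> * \<beta> / 2 + \<kappa> * (real (\<omega> k) - 2 * real (parent \<omega> k))"
      using tr_pos[OF k] by (intro balance) auto
  qed simp
  also have "\<dots> = - s * (\<Sum>k=1..n. rate l0 l1 (\<omega> k)) + \<beta> * pairs \<omega> n - n * (\<alpha> * \<beta> / 2)
      + \<kappa> * (ones \<omega> n - 2 * (\<Sum>k=1..n. real (parent \<omega> k)))"
    unfolding pairs_def ones_def
    by (simp only: sum.distrib sum_subtractf sum_distrib_left[symmetric]) simp
  finally show ?thesis
    unfolding sum_parent by (simp add: len_def algebra_simps)
qed

lemma mass_pos: "0 < q \<Longrightarrow> 0 < mass p q \<omega> n"
  unfolding mass_def using p q by (intro prod_pos) (simp add: tr_def)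

text \<open>For n = 2k with k = 2^j the \<kappa> term is 2k times an increment of a bounded
  sequence, hence not very negative infinitely often. In the \<beta> term only the sign of \<beta>
  (\<alpha>' - \<alpha>) counts, so the chain for \<alpha> also serves other levels
  \<alpha>'.\<close>

lemma mass_frequently_large:
  fixes \<eta> :: real
  assumes \<omega>: "\<omega> \<in> binary_seqs" and "0 < q" "\<eta> > 0"
    and lim: "(\<lambda>n. pairs \<omega> (2 * n) / n) \<longlonglongrightarrow> \<alpha>'" "0 \<le> \<beta> * (\<alpha>' - \<alpha>)"
  shows "\<exists>n\<ge>N. s * ln (len l0 l1 \<omega> n) - \<eta> * n \<le> ln (mass p q \<omega> n)"
proof -
  have "(\<lambda>n. \<beta> * (pairs \<omega> (2 * n) / n - \<alpha>)) \<longlonglongrightarrow> \<beta> * (\<alpha>' - \<alpha>)"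
    using lim(1) by (intro tendsto_intros)
  then have "\<forall>\<^sub>F n in sequentially. - \<eta> < \<beta> * (pairs \<omega> (2 * n) / n - \<alpha>)"
    using lim(2) \<open>\<eta> > 0\<close> by (intro order_tendstoD(1)) auto
  then obtain M where M: "\<And>n. n \<ge> M \<Longrightarrow> - \<eta> < \<beta> * (pairs \<omega> (2 * n) / n - \<alpha>)"
    by (auto simp: eventually_sequentially)
  define a where "a = (\<lambda>j. \<kappa> * (ones \<omega> (2 ^ j) / 2 ^ j))"
  have "\<bar>a j\<bar> \<le> \<bar>\<kappa>\<bar>" for j
  proof -
    have "\<bar>ones \<omega> (2 ^ j) / 2 ^ j\<bar> \<le> 1"
      using ones_bounds[of "2 ^ j" \<omega>] binary_cases[OF \<omega>] by simp
    then show ?thesis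
      unfolding a_def abs_mult by (rule mult_left_le) simp
  qed
  then obtain j where j: "j \<ge> M + N" "- (\<eta> / 2) \<le> a (Suc j) - a j"
    using bounded_increments[of a "\<bar>\<kappa>\<bar>" "\<eta> / 2" "M + N"] \<open>\<eta> > 0\<close> by auto
  define k :: nat where "k = 2 ^ j"
  have k: "j < k" "0 < real k"
    by (auto simp: k_def)
  have "a (Suc j) - a j = \<kappa> * (ones \<omega> (2 * k) - 2 * ones \<omega> k) / (2 * k)"
    by (simp add: a_def k_def field_simps)
  \<comment> \<open>The \<kappa> term and the \<beta> term each lose at most \<eta> k, together
    \<eta> n for n = 2k.\<close>
  then have "- (\<eta> / 2) * (2 * k) \<le> \<kappa> * (ones \<omega> (2 * k) - 2 * ones \<omega> k)"
    using j(2) k by (simp add: pos_le_divide_eq)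
  moreover have "- \<eta> * k \<le> \<beta> * (pairs \<omega> (2 * k) / k - \<alpha>) * k"
    using M[of k] j k by (intro mult_right_mono) auto
  moreover have "\<beta> * (pairs \<omega> (2 * k) / k - \<alpha>) * k = \<beta> * (pairs \<omega> (2 * k) - \<alpha> * k)"
    using k by (simp add: field_simps)
  moreover have "ln (mass p q \<omega> (2 * k)) = s * ln (len l0 l1 \<omega> (2 * k)) +
      \<beta> * (pairs \<omega> (2 * k) - \<alpha> * k) + \<kappa> * (ones \<omega> (2 * k) - 2 * ones \<omega> k)"
    using ln_mass[of "2 * k" \<omega>] binary_cases[OF \<omega>] mass_pos[OF \<open>0 < q\<close>] by simp
  ultimately show ?thesis
    using j k by (intro exI[of _ "2 * k"]) auto
qed

text \<open>Words of nearly the expected mass satisfy len^t \<le> exp (-\<eta> n) * mass, and masses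
  add up to at most 1, so their intervals form covers of geometrically decreasing size. By
  \<open>mass_frequently_large\<close> they cover each point infinitely often.\<close>

lemma hausdorff_measure_projection_zero:
  assumes "0 < q" "0 \<le> s" "s < t" and E: "E \<subseteq> binary_seqs"
    and lim: "\<And>\<omega>. \<omega> \<in> E \<Longrightarrow> \<exists>\<alpha>'. (\<lambda>n. pairs \<omega> (2 * n) / n) \<longlonglongrightarrow> \<alpha>' \<and> 0 \<le> \<beta> * (\<alpha>' - \<alpha>)"
  shows "hausdorff_measure t (natural_proj l0 l1 ` E) = 0"
proof -
  \<comment> \<open>The exponent gap t - s gains a factor exp (-2\<eta> n); half of the exponent
    pays for the loss allowed in \<open>V\<close>, the other half makes the series converge.\<close>
  define \<eta> where "\<eta> = min l0 l1 * (t - s) / 2"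
  have \<eta>: "\<eta> > 0"
    using l0 l1 \<open>s < t\<close> by (simp add: \<eta>_def)
  define V where "V = (\<lambda>n. {v \<in> words n. s * ln (len l0 l1 v n) - \<eta> * n \<le> ln (mass p q v n)})"
  define I where "I = (\<lambda>n v. {left l0 l1 v n..left l0 l1 v n + len l0 l1 v n})"
  have diam: "diameter (I n v) = len l0 l1 v n" for n v
    using len_pos[of l0 l1 v n] by (simp add: I_def)
  show ?thesis
  proof (rule hausdorff_measure_cantelli[where V = V and I = I])
    show "finite (V n)" for n
      by (simp add: V_def)
    show "bounded (I n v)" for n v
      by (simp add: I_def)
    show "diameter (I n v) \<le> exp (- (min l0 l1 * n))" for n v
      by (simp add: diam len_le)
    show "(\<lambda>n. exp (- (min l0 l1 * real n))) \<longlonglongrightarrow> 0"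
      using l0 l1 by real_asymp
    show "(\<Sum>v\<in>V n. diam_power t (I n v)) \<le> ennreal (exp (- \<eta>) ^ n)" for n
    proof -
      have le: "len l0 l1 v n powr t \<le> exp (- \<eta>) ^ n * mass p q v n" if "v \<in> V n" for v
      proof -
        have "ln (len l0 l1 v n) \<le> - (min l0 l1 * n)"
          using len_le[of v n] len_pos[of l0 l1 v n] by (metis exp_le_cancel_iff exp_ln)
        then have "(t - s) * ln (len l0 l1 v n) \<le> (t - s) * (- (min l0 l1 * n))"
          using \<open>s < t\<close> by (intro mult_left_mono) auto
        also have "\<dots> = - 2 * \<eta> * n"
          by (simp add: \<eta>_def)
        finally have "t * ln (len l0 l1 v n) \<le> - \<eta> * n + (s * ln (len l0 l1 v n) - \<eta> * n)"
          by (simp add: algebra_simps)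
        also have "\<dots> \<le> - \<eta> * n + ln (mass p q v n)"
          using that by (simp add: V_def)
        finally have "exp (t * ln (len l0 l1 v n)) \<le> exp (- \<eta> * n) * exp (ln (mass p q v n))"
          by (simp flip: exp_add)
        then show ?thesis
          using len_pos[of l0 l1 v n] mass_pos[OF \<open>0 < q\<close>, of v n]
          by (simp add: powr_def exp_of_nat_mult[symmetric] mult.commute)
      qed
      have diam_eq: "diam_power t (I n v) = ennreal (len l0 l1 v n powr t)" for v
      proof -
        have "I n v \<noteq> {}"
          using len_pos[of l0 l1 v n] by (simp add: I_def)
        then show ?thesis
          using \<open>0 \<le> s\<close> \<open>s < t\<close> by (simp add: diam_power_def diam)
      qed
      have "(\<Sum>v\<in>V n. diam_power t (I n v)) = ennreal (\<Sum>v\<in>V n. len l0 l1 v n powr t)"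
        using diam_eq by simp
      also have "(\<Sum>v\<in>V n. len l0 l1 v n powr t) \<le> (\<Sum>v\<in>V n. exp (- \<eta>) ^ n * mass p q v n)"
        by (intro sum_mono le)
      also have "\<dots> \<le> (\<Sum>v\<in>words n. exp (- \<eta>) ^ n * mass p q v n)"
        using mass_nonneg[OF pq] by (intro sum_mono2) (auto simp: V_def)
      also have "\<dots> = exp (- \<eta>) ^ n"
        by (simp add: sum_distrib_left[symmetric] sum_mass)
      finally show ?thesis
        by (simp add: ennreal_leI)
    qed
    show "summable (\<lambda>n. exp (- \<eta>) ^ n)"
      using \<eta> by (intro summable_geometric) auto
    show "0 \<le> exp (- \<eta>) ^ n" for n
      by simp
    fix x N assume "x \<in> natural_proj l0 l1 ` E"
    then obtain \<omega> where \<omega>: "\<omega> \<in> E" "x = natural_proj l0 l1 \<omega>"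
      by blast
    then obtain n where n: "n \<ge> N" "s * ln (len l0 l1 \<omega> n) - \<eta> * n \<le> ln (mass p q \<omega> n)"
      using mass_frequently_large[OF _ \<open>0 < q\<close> \<eta>] E lim by (meson subsetD)
    define v where "v = restrict \<omega> {1..n}"
    have v: "len l0 l1 v n = len l0 l1 \<omega> n" "left l0 l1 v n = left l0 l1 \<omega> n" "mass p q v n = mass p q \<omega> n"
      by (intro len_cong left_cong mass_cong; simp add: v_def)+
    have "v \<in> V n"
      using n \<omega> E restrict_binary[of \<omega> n] v by (auto simp: V_def v_def)
    moreover have "x \<in> I n v"
      using natural_proj_bounds[of \<omega> n] \<omega> v by (simp add: I_def)
    ultimately show "\<exists>n\<ge>N. \<exists>v\<in>V n. x \<in> I n v"
      using n by blast
  qed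
qed

text \<open>The second equation of the system says q m = \<alpha> for the limiting density
  \<open>m\<close> of ones, and q m is the limiting pair frequency.\<close>

lemma typical_pairs_limit:
  assumes \<alpha>: "2 * p * q = \<alpha> * (2 + p - q)" and \<omega>: "\<omega> \<in> binary_seqs" "typical p q N \<omega>"
  shows "(\<lambda>n. pairs \<omega> (2 * n) / n) \<longlonglongrightarrow> \<alpha>"
proof (rule LIMSEQ_I)
  fix e :: real assume "e > 0"
  define m where "m = 2 * p / (2 + p - q)"
  have m: "m * (2 + p - q) = 2 * p" "q * m = \<alpha>"
    using p q \<alpha> by (simp_all add: m_def field_simps)
  have "e / 4 > 0"
    using \<open>e > 0\<close> by simp
  then obtain C where C: "0 \<le> C" "\<And>\<omega> n. \<omega> \<in> binary_seqs \<Longrightarrow> typical p q N \<omega> \<Longrightarrow>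
    \<bar>ones \<omega> n - m * n\<bar> \<le> e / 4 * n + C"
    "\<And>\<omega> n. \<omega> \<in> binary_seqs \<Longrightarrow> typical p q N \<omega> \<Longrightarrow> \<bar>ones \<omega> (n div 2) - m * n / 2\<bar> \<le> e / 4 * n + C"
    "\<And>\<omega> n. \<omega> \<in> binary_seqs \<Longrightarrow> typical p q N \<omega> \<Longrightarrow> \<bar>pairs \<omega> n - q * m * n / 2\<bar> \<le> e / 4 * n + C"
    using typical_frequencies[OF p q _ m(1), where N = N] by blast
  obtain M :: nat where M: "2 * C / e < M"
    using reals_Archimedean2 by blast
  show "\<exists>M. \<forall>n\<ge>M. norm (pairs \<omega> (2 * n) / n - \<alpha>) < e"
  proof (intro exI allI impI)
    fix n assume "n \<ge> M"
    have "0 \<le> 2 * C / e"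
      using C(1) \<open>e > 0\<close> by simp
    moreover have "2 * C / e < n"
      using M \<open>n \<ge> M\<close> by linarith
    ultimately have n: "0 < real n" "2 * C < e * n"
      using \<open>e > 0\<close> by (linarith, simp add: field_simps)
    have "\<bar>pairs \<omega> (2 * n) - \<alpha> * n\<bar> \<le> e / 2 * n + C"
      using C(4)[OF \<omega>, of "2 * n"] m(2) by simp
    also have "\<dots> < e * n"
      using n by simp
    finally have "\<bar>pairs \<omega> (2 * n) - \<alpha> * n\<bar> / n < e"
      using n by (simp add: pos_divide_less_eq)
    moreover have "pairs \<omega> (2 * n) / n - \<alpha> = (pairs \<omega> (2 * n) - \<alpha> * n) / n"
      using n by (simp add: field_simps)
    ultimately show "norm (pairs \<omega> (2 * n) / n - \<alpha>) < e"
      by simp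
  qed
qed

text \<open>For typical sequences the error terms in \<open>ln_mass\<close> are arbitrarily small
  multiples of \<open>n\<close>, whereas lowering the exponent from \<open>s\<close> to
  \<open>t\<close> gains a fixed multiple of \<open>n\<close>.\<close>

lemma hausdorff_measure_projection_nonzero:
  assumes \<alpha>: "2 * p * q = \<alpha> * (2 + p - q)" and "0 \<le> t" "t < s"
    and E: "\<And>N \<omega>. \<omega> \<in> binary_seqs \<Longrightarrow> typical p q N \<omega> \<Longrightarrow> \<omega> \<in> E"
  shows "hausdorff_measure t (natural_proj l0 l1 ` E) \<noteq> 0"
proof (rule hausdorff_measure_projection_pos[OF pq \<open>0 \<le> t\<close> E])
  fix N
  define m where "m = 2 * p / (2 + p - q)"
  have m: "m * (2 + p - q) = 2 * p" "q * m = \<alpha>"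
    using p q \<alpha> by (simp_all add: m_def field_simps)
  \<comment> \<open>In \<open>ones \<omega> n - 2 * ones \<omega> (n div 2)\<close> the means cancel
    and 1 + 2 frequency errors remain, whence the 3; the final 1 keeps \<open>K\<close>
    positive.\<close>
  define K where "K = \<bar>\<beta>\<bar> + 3 * \<bar>\<kappa>\<bar> + 1"
  have K: "K > 0"
    by (simp add: K_def)
  define d where "d = (s - t) * min l0 l1"
  have d: "d > 0"
    using l0 l1 \<open>t < s\<close> by (simp add: d_def)
  have "d / (2 * K) > 0"
    using d K by simp
  then obtain C where C: "0 \<le> C" "\<And>\<omega> n. \<omega> \<in> binary_seqs \<Longrightarrow> typical p q N \<omega> \<Longrightarrow>
    \<bar>ones \<omega> n - m * n\<bar> \<le> d / (2 * K) * n + C"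
    "\<And>\<omega> n. \<omega> \<in> binary_seqs \<Longrightarrow> typical p q N \<omega> \<Longrightarrow> \<bar>ones \<omega> (n div 2) - m * n / 2\<bar> \<le> d / (2 * K) * n + C"
    "\<And>\<omega> n. \<omega> \<in> binary_seqs \<Longrightarrow> typical p q N \<omega> \<Longrightarrow> \<bar>pairs \<omega> n - q * m * n / 2\<bar> \<le> d / (2 * K) * n + C"
    using typical_frequencies[OF p q _ m(1), where N = N] by blast
  \<comment> \<open>The frequency error d / (2K) spends half of the gain d n; from \<open>n0\<close>
    on the other half absorbs K C.\<close>
  obtain n0 :: nat where n0: "2 * K * C / d < n0"
    using reals_Archimedean2 by blast
  have "mass p q \<omega> n \<le> len l0 l1 \<omega> n powr t"
    if "n \<ge> n0" and \<omega>: "\<omega> \<in> binary_seqs" "typical p q N \<omega>" for n \<omega>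
  proof -
    have pos: "mass p q \<omega> n > 0"
      using \<omega>(2) by (simp add: typical_def)
    define B where "B = d / (2 * K) * n + C"
    have "2 * K * C / d \<le> n"
      using n0 \<open>n \<ge> n0\<close> by simp
    then have "K * B \<le> d * n"
      using K d by (simp add: B_def field_simps)
    have "\<bar>ones \<omega> n - 2 * ones \<omega> (n div 2)\<bar> \<le> 3 * B"
      using C(2,3)[OF \<omega>, of n] unfolding B_def[symmetric] by linarith
    then have "\<kappa> * (ones \<omega> n - 2 * ones \<omega> (n div 2)) \<le> \<bar>\<kappa>\<bar> * (3 * B)"
      by (rule le_abs_mult)
    moreover have "\<bar>pairs \<omega> n - \<alpha> * n / 2\<bar> \<le> B"
      using C(4)[OF \<omega>, of n] m(2) by (simp add: B_def)
    then have "\<beta> * (pairs \<omega> n - \<alpha> * n / 2) \<le> \<bar>\<beta>\<bar> * B"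
      by (rule le_abs_mult)
    moreover have "0 \<le> B"
      using C(1) d K by (simp add: B_def)
    ultimately have "ln (mass p q \<omega> n) \<le> s * ln (len l0 l1 \<omega> n) + K * B"
      using ln_mass[OF binary_cases[OF \<omega>(1)] pos] by (simp add: K_def algebra_simps)
    also have "\<dots> \<le> s * ln (len l0 l1 \<omega> n) + d * n"
      using \<open>K * B \<le> d * n\<close> by simp
    also have "\<dots> \<le> t * ln (len l0 l1 \<omega> n)"
    proof -
      have "ln (len l0 l1 \<omega> n) \<le> - (min l0 l1 * n)"
        using len_le[of \<omega> n] len_pos[of l0 l1 \<omega> n] by (metis exp_le_cancel_iff exp_ln)
      then have "(s - t) * ln (len l0 l1 \<omega> n) \<le> (s - t) * (- (min l0 l1 * n))"
        using \<open>t < s\<close> by (intro mult_left_mono) auto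
      then show ?thesis
        by (simp add: d_def algebra_simps)
    qed
    finally have "exp (ln (mass p q \<omega> n)) \<le> exp (t * ln (len l0 l1 \<omega> n))"
      by simp
    then show ?thesis
      using pos len_pos[of l0 l1 \<omega> n] by (simp add: powr_def)
  qed
  then show "\<exists>n0. \<forall>n\<ge>n0. \<forall>\<omega>\<in>binary_seqs. typical p q N \<omega> \<longrightarrow> mass p q \<omega> n \<le> len l0 l1 \<omega> n powr t"
    by blast
qed

end

lemma A_level_iff:
  "\<omega> \<in> A_level \<alpha> \<longleftrightarrow> \<omega> \<in> binary_seqs \<and> (\<lambda>n. pairs \<omega> (2 * n) / n) \<longlonglongrightarrow> \<alpha>"
  by (simp add: A_level_def pairs_double)

lemma A_set_subset: "A_set \<subseteq> A_level 0"
proof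
  fix \<omega> assume \<omega>: "\<omega> \<in> A_set"
  then have "(\<Sum>k=1..n. real (\<omega> k * \<omega> (2 * k))) = 0" for n
    by (intro sum.neutral) (auto simp: A_set_def)
  then show "\<omega> \<in> A_level 0"
    using \<omega> by (simp add: A_level_def A_set_def)
qed

section \<open>Dimensions of the level sets\<close>

text \<open>Positive arguments of the logarithms exclude the boundary of the square; in its interior
  the logarithms split.\<close>

lemma solves_system_iff:
  "solves_system l0 l1 \<alpha> p q \<longleftrightarrow> 0 < p \<and> p < 1 \<and> 0 < q \<and> q < 1 \<and>
     \<alpha> * (l1 - l0) * (ln p + ln (1 - q) - ln (1 - p) - ln q)
       + l0 * (2 * ln p + ln (1 - q) - ln (1 - p)) - 2 * l1 * ln (1 - p) = 0 \<and>
     2 * p * q = \<alpha> * (2 + p - q)" (is "?A \<longleftrightarrow> ?B")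
proof -
  have ln1: "ln (p * (1 - q) / ((1 - p) * q)) = ln p + ln (1 - q) - ln (1 - p) - ln q"
    "ln (p\<^sup>2 * (1 - q) / (1 - p)) = 2 * ln p + ln (1 - q) - ln (1 - p)"
    if "0 < p" "p < 1" "0 < q" "q < 1"
    using that by (simp_all add: ln_div ln_mult ln_realpow)
  show ?thesis
  proof
    assume A: ?A
    then have "0 < q" "p < 1"
      unfolding solves_system_def by auto
    moreover have "0 < p\<^sup>2 * (1 - q)" "0 \<le> p" "q \<le> 1"
      using A \<open>p < 1\<close> unfolding solves_system_def by (auto simp: zero_less_divide_iff)
    then have "0 < p" "q < 1"
      by (auto simp: zero_less_mult_iff less_le)
    ultimately show ?B
      using A ln1 unfolding solves_system_def by auto
  next
    assume B: ?B
    then show ?A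
      unfolding solves_system_def using ln1 by auto
  qed
qed

lemma dim_formula_eq:
  assumes "0 < p" "p < 1" "0 < q" "q < 1"
  shows "dim_formula l0 \<alpha> p q = (\<alpha> * (ln p + ln (1 - q) - ln (1 - p) - ln q) - 2 * ln (1 - p)) / (2 * l0)"
  using assms by (simp add: dim_formula_def ln_div ln_mult)

section \<open>From the system of equations to a balanced chain\<close>

context ifs_pair
begin

text \<open>Four balance equations meet three unknowns. The logarithm of the cross ratio of the four
  probabilities gives \<beta>, then the transition (0,0) gives the dimension and (0,1) gives
  \<kappa>; compatibility at (1,0) is the first equation.\<close>

lemma balanced_chainI:
  assumes "0 < p" "p < 1" "0 < q" "q < 1"
    and eq: "\<alpha> * (l1 - l0) * (ln p + ln (1 - q) - ln (1 - p) - ln q)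
       + l0 * (2 * ln p + ln (1 - q) - ln (1 - p)) - 2 * l1 * ln (1 - p) = 0"
  shows "\<exists>\<kappa>. balanced_chain l0 l1 p q \<alpha> (- (ln p + ln (1 - q) - ln (1 - p) - ln q)) \<kappa> (dim_formula l0 \<alpha> p q)"
proof -
  define L where "L = ln p + ln (1 - q) - ln (1 - p) - ln q"
  define s where "s = dim_formula l0 \<alpha> p q"
  define \<kappa> where "\<kappa> = ln p - ln (1 - p) + s * (l1 - l0)"
  have s0: "s * l0 = \<alpha> * L / 2 - ln (1 - p)"
    using l0 by (simp add: s_def dim_formula_eq assms L_def field_simps)
  have "l0 * (2 * (s * (l1 - l0))) = l0 * (3 * ln (1 - p) - 2 * ln p - ln (1 - q))"
  proof -
    have "l0 * (2 * (s * (l1 - l0))) = 2 * (s * l0) * (l1 - l0)"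
      by (simp add: algebra_simps)
    also have "\<dots> = (\<alpha> * L - 2 * ln (1 - p)) * (l1 - l0)"
      by (simp add: s0)
    also have "\<dots> = l0 * (3 * ln (1 - p) - 2 * ln p - ln (1 - q))"
      using eq unfolding L_def[symmetric] by (simp add: algebra_simps)
    finally show ?thesis .
  qed
  then have s1: "2 * (s * (l1 - l0)) = 3 * ln (1 - p) - 2 * ln p - ln (1 - q)"
    using l0 by simp
  have "balanced_chain l0 l1 p q \<alpha> (- L) \<kappa> s"
  proof unfold_locales
    fix a b :: nat assume "a \<in> {0, 1}" "b \<in> {0, 1}"
    then consider "a = 0" "b = 0" | "a = 0" "b = 1" | "a = 1" "b = 0" | "a = 1" "b = 1"
      by auto
    then show "ln (tr p q a b) =
       - s * rate l0 l1 b + - L * real (a * b) - \<alpha> * - L / 2 + \<kappa> * (real b - 2 * real a)"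
      by cases (use s0 s1 in \<open>simp_all add: tr_def rate_def \<kappa>_def L_def field_simps\<close>)
  qed (use assms in auto)
  then show ?thesis
    unfolding L_def s_def by blast
qed

text \<open>The first equation trades \<open>l0\<close> for \<open>l1\<close> in the dimension
  formula. This form serves where the log cross ratio is negative, in particular near \<alpha> =
  1.\<close>

lemma dim_formula_l1:
  assumes "0 < p" "p < 1" "0 < q" "q < 1"
    and eq: "\<alpha> * (l1 - l0) * (ln p + ln (1 - q) - ln (1 - p) - ln q)
       + l0 * (2 * ln p + ln (1 - q) - ln (1 - p)) - 2 * l1 * ln (1 - p) = 0"
  shows "2 * l1 * dim_formula l0 \<alpha> p q =
     - (1 - \<alpha>) * (ln p + ln (1 - q) - ln (1 - p) - ln q) - (ln p + ln q)"
proof -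
  define L where "L = ln p + ln (1 - q) - ln (1 - p) - ln q"
  define s where "s = dim_formula l0 \<alpha> p q"
  have s0: "2 * l0 * s = \<alpha> * L - 2 * ln (1 - p)"
    using l0 by (simp add: s_def dim_formula_eq assms L_def field_simps)
  have "l0 * (2 * l1 * s) = l1 * (2 * l0 * s)"
    by simp
  also have "\<dots> = l1 * (\<alpha> * L - 2 * ln (1 - p))"
    by (simp only: s0)
  also have "\<dots> = l0 * (- (1 - \<alpha>) * L - (ln p + ln q))"
    using eq unfolding L_def by (simp add: algebra_simps)
  finally show ?thesis
    using l0 by (simp add: L_def s_def)
qed

text \<open>If the log cross ratio is nonnegative, the defining formula consists of nonnegative
  terms; otherwise the form with \<open>l1\<close> does.\<close>

lemma dim_formula_nonneg:
  assumes "0 < p" "p < 1" "0 < q" "q < 1" "0 \<le> \<alpha>" "\<alpha> \<le> 1"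
    and eq: "\<alpha> * (l1 - l0) * (ln p + ln (1 - q) - ln (1 - p) - ln q)
       + l0 * (2 * ln p + ln (1 - q) - ln (1 - p)) - 2 * l1 * ln (1 - p) = 0"
  shows "0 \<le> dim_formula l0 \<alpha> p q"
proof (cases "0 \<le> ln p + ln (1 - q) - ln (1 - p) - ln q")
  case True
  moreover have "ln (1 - p) \<le> 0"
    using assms by (simp add: ln_le_zero_iff)
  ultimately show ?thesis
    using assms(5) l0 unfolding dim_formula_eq[OF assms(1-4)]
    by (intro divide_nonneg_pos add_nonneg_nonneg mult_nonneg_nonneg
        diff_ge_0_iff_ge[THEN iffD2] order_trans[OF _ mult_nonneg_nonneg]) auto
next
  case False
  define L where "L = ln p + ln (1 - q) - ln (1 - p) - ln q"
  have "0 \<le> (1 - \<alpha>) * (- L)"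
    using False assms by (intro mult_nonneg_nonneg) (auto simp: L_def)
  then have "0 \<le> - (1 - \<alpha>) * L"
    by (simp only: mult_minus_left mult_minus_right)
  moreover have "ln p \<le> 0" "ln q \<le> 0"
    using assms by auto
  ultimately have "0 \<le> - (1 - \<alpha>) * L - (ln p + ln q)"
    by linarith
  then have "0 \<le> 2 * l1 * dim_formula l0 \<alpha> p q"
    unfolding dim_formula_l1[OF assms(1-4) eq] L_def .
  then show ?thesis
    using l1 by (simp add: zero_le_mult_iff)
qed

lemma A_level_subset: "A_level \<alpha> \<subseteq> binary_seqs"
  by (auto simp: A_level_def)

text \<open>The hypotheses ask for the first equation alone, and the level \<alpha>' may differ from
  \<alpha>. This yields the upper bounds at levels 0 and 1, where the full system has no
  solution.\<close>

lemma hausdorff_measure_L_level_zero: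
  assumes "0 < p" "p < 1" "0 < q" "q < 1" "0 \<le> \<alpha>" "\<alpha> \<le> 1"
    and eq: "\<alpha> * (l1 - l0) * (ln p + ln (1 - q) - ln (1 - p) - ln q)
       + l0 * (2 * ln p + ln (1 - q) - ln (1 - p)) - 2 * l1 * ln (1 - p) = 0"
    and level: "0 \<le> - (ln p + ln (1 - q) - ln (1 - p) - ln q) * (\<alpha>' - \<alpha>)"
    and "dim_formula l0 \<alpha> p q < t"
  shows "hausdorff_measure t (L_level l0 l1 \<alpha>') = 0"
proof -
  obtain \<kappa> where "balanced_chain l0 l1 p q \<alpha> (- (ln p + ln (1 - q) - ln (1 - p) - ln q)) \<kappa> (dim_formula l0 \<alpha> p q)"
    using balanced_chainI[OF assms(1-4) eq] by blast
  then show ?thesis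
    unfolding L_level_def
    by (rule balanced_chain.hausdorff_measure_projection_zero)
      (use assms dim_formula_nonneg[OF assms(1-6) eq] A_level_subset level in \<open>auto simp: A_level_iff\<close>)
qed

lemma hausdorff_dim_L_level:
  assumes sol: "solves_system l0 l1 \<alpha> p q" and \<alpha>: "0 < \<alpha>" "\<alpha> < 1"
  shows "hausdorff_dim (L_level l0 l1 \<alpha>) = dim_formula l0 \<alpha> p q"
proof -
  have pq: "0 < p" "p < 1" "0 < q" "q < 1"
    and eq: "\<alpha> * (l1 - l0) * (ln p + ln (1 - q) - ln (1 - p) - ln q)
       + l0 * (2 * ln p + ln (1 - q) - ln (1 - p)) - 2 * l1 * ln (1 - p) = 0"
    and eq2: "2 * p * q = \<alpha> * (2 + p - q)"
    using sol by (auto simp: solves_system_iff)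
  show ?thesis
  proof (rule hausdorff_dim_eqI)
    show "0 \<le> dim_formula l0 \<alpha> p q"
      using pq \<alpha> eq by (intro dim_formula_nonneg) auto
    show "hausdorff_measure t (L_level l0 l1 \<alpha>) = 0" if "dim_formula l0 \<alpha> p q < t" for t
      using pq \<alpha> eq that by (intro hausdorff_measure_L_level_zero[of p q \<alpha> \<alpha>]) auto
    fix t assume t: "0 \<le> t" "t < dim_formula l0 \<alpha> p q"
    obtain \<kappa> where chain: "balanced_chain l0 l1 p q \<alpha> (- (ln p + ln (1 - q) - ln (1 - p) - ln q)) \<kappa> (dim_formula l0 \<alpha> p q)"
      using balanced_chainI[OF pq eq] by blast
    show "hausdorff_measure t (L_level l0 l1 \<alpha>) \<noteq> 0"
      unfolding L_level_def
    proof (rule balanced_chain.hausdorff_measure_projection_nonzero[OF chain eq2 t])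
      show "\<omega> \<in> A_level \<alpha>" if "\<omega> \<in> binary_seqs" "typical p q N \<omega>" for N \<omega>
        using balanced_chain.typical_pairs_limit[OF chain eq2 that] that by (simp add: A_level_iff)
    qed
  qed
qed

section \<open>The set A and the level 0\<close>

lemma golden_mean_equation_log:
  assumes "p \<in> {0..1}" "p powr (2 * l0) = (1 - p) powr (2 * l1 + l0)"
  shows "0 < p" "p < 1" "2 * l0 * ln p = (2 * l1 + l0) * ln (1 - p)"
proof -
  have "p \<noteq> 0" "p \<noteq> 1"
    using assms by auto
  then show "0 < p" "p < 1"
    using assms(1) by auto
  then show "2 * l0 * ln p = (2 * l1 + l0) * ln (1 - p)"
    using arg_cong[OF assms(2), of ln] by (simp add: ln_powr)
qed

text \<open>The difference of the two sides increases strictly from -1 to 1 on the unit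
  interval.\<close>

lemma golden_mean_equation_ex1: "\<exists>!p. p \<in> {0..1} \<and> p powr (2 * l0) = (1 - p) powr (2 * l1 + l0)"
proof -
  define G where "G = (\<lambda>p. p powr (2 * l0) - (1 - p) powr (2 * l1 + l0))"
  have "continuous_on {0..1} G"
    unfolding G_def using l0 l1 by (intro continuous_intros continuous_on_powr') auto
  moreover have "G 0 = -1" "G 1 = 1"
    using l0 l1 by (auto simp: G_def)
  ultimately obtain p where p: "0 \<le> p" "p \<le> 1" "G p = 0"
    using IVT'[of G 0 0 1] by auto
  have mono: "G x < G y" if "0 \<le> x" "x < y" "y \<le> 1" for x y
  proof -
    have "x powr (2 * l0) < y powr (2 * l0)" "(1 - y) powr (2 * l1 + l0) < (1 - x) powr (2 * l1 + l0)"
      using that l0 l1 by (auto intro!: powr_less_mono2)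
    then show ?thesis by (simp add: G_def)
  qed
  show ?thesis
  proof (rule ex1I[of _ p])
    show "p \<in> {0..1} \<and> p powr (2 * l0) = (1 - p) powr (2 * l1 + l0)"
      using p by (simp add: G_def)
    fix x assume "x \<in> {0..1} \<and> x powr (2 * l0) = (1 - x) powr (2 * l1 + l0)"
    then have "0 \<le> x" "x \<le> 1" "G x = 0"
      by (auto simp: G_def)
    then show "x = p"
      using mono[of x p] mono[of p x] p by linarith
  qed
qed

text \<open>The limiting chain for \<open>\<alpha> = 0\<close> has \<open>q = 0\<close>: along a chain no two consecutive
  states are 1.\<close>

lemma golden_mean_chain:
  assumes "0 < p" "p < 1" and eq: "2 * l0 * ln p = (2 * l1 + l0) * ln (1 - p)"
  shows "\<exists>\<kappa>. balanced_chain l0 l1 p 0 0 0 \<kappa> (- ln (1 - p) / l0)"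
proof -
  define s where "s = - ln (1 - p) / l0"
  have s0: "s * l0 = - ln (1 - p)"
    using l0 by (simp add: s_def)
  have "l0 * (2 * (s * (l1 - l0))) = 2 * (s * l0) * (l1 - l0)"
    by (simp add: algebra_simps)
  also have "\<dots> = 2 * (- ln (1 - p)) * (l1 - l0)"
    by (simp only: s0)
  also have "\<dots> = l0 * (3 * ln (1 - p) - 2 * ln p)"
    using eq by (simp add: algebra_simps)
  finally have s1: "2 * (s * (l1 - l0)) = 3 * ln (1 - p) - 2 * ln p"
    using l0 by simp
  have "balanced_chain l0 l1 p 0 0 0 (ln p - ln (1 - p) + s * (l1 - l0)) s"
  proof unfold_locales
    \<comment> \<open>The transition from 1 to 1 has probability 0 and drops out. Three equations
      remain for \<open>s\<close> and \<kappa>, and their compatibility is the equation for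
      \<open>p\<close>.\<close>
    fix a b :: nat assume "a \<in> {0, 1}" "b \<in> {0, 1}" "tr p 0 a b > 0"
    then consider "a = 0" "b = 0" | "a = 0" "b = 1" | "a = 1" "b = 0"
      by (auto simp: tr_def)
    then show "ln (tr p 0 a b) = - s * rate l0 l1 b + 0 * real (a * b) - 0 * 0 / 2
        + (ln p - ln (1 - p) + s * (l1 - l0)) * (real b - 2 * real a)"
      by cases (use s0 s1 in \<open>simp_all add: tr_def rate_def algebra_simps\<close>)
  qed (use assms in auto)
  then show ?thesis
    unfolding s_def by blast
qed

text \<open>Ones at both k and 2k would use the transition of probability 0, so typical sequences
  lie in \<open>A_set\<close> itself and not merely in the level 0.\<close>

lemma typical_golden_mean:
  assumes "\<omega> \<in> binary_seqs" "typical p 0 N \<omega>"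
  shows "\<omega> \<in> A_set"
proof -
  have "\<omega> k * \<omega> (2 * k) = 0" if "k \<ge> 1" for k
  proof (rule ccontr)
    assume "\<omega> k * \<omega> (2 * k) \<noteq> 0"
    then have "tr p 0 (parent \<omega> (2 * k)) (\<omega> (2 * k)) = 0"
      by (simp add: tr_def parent_def)
    then have "mass p 0 \<omega> (2 * k) = 0"
      unfolding mass_def using that by (intro prod_zero) (auto intro!: bexI[of _ "2 * k"])
    then show False
      using assms(2) unfolding typical_def by (metis less_irrefl)
  qed
  then show ?thesis
    using assms(1) by (simp add: A_set_def)
qed

text \<open>The lower bound is proved for the smaller set, the upper bound for the larger one. The
  limiting chain has null words, so the upper bound uses chains with q > 0 and p' slightly above
  \<open>p\<close>.\<close>

lemma hausdorff_dim_golden_mean: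
  assumes p: "0 < p" "p < 1" and eq: "2 * l0 * ln p = (2 * l1 + l0) * ln (1 - p)"
  shows "hausdorff_dim (L_set l0 l1) = - ln (1 - p) / l0"
    and "hausdorff_dim (L_level l0 l1 0) = - ln (1 - p) / l0"
proof -
  have sub: "L_set l0 l1 \<subseteq> L_level l0 l1 0"
    unfolding L_set_def L_level_def using A_set_subset by blast
  have nonneg: "0 \<le> - ln (1 - p) / l0"
    using p l0 by (intro divide_nonneg_pos) auto
  have upper: "hausdorff_measure t (L_level l0 l1 0) = 0" if t: "- ln (1 - p) / l0 < t" for t
  proof -
    have "- (t * l0) < ln (1 - p)"
      using t l0 by (simp add: field_simps)
    then have "exp (- (t * l0)) < 1 - p"
      using p by (metis diff_gt_0_iff_gt exp_less_cancel_iff exp_ln)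
    \<comment> \<open>At the upper end 1 - exp (- (t * l0)) the value - ln (1 - p') / l0 would equal
      \<open>t\<close>; below it the value stays under \<open>t\<close>.\<close>
    then obtain p' where p': "p < p'" "p' < 1 - exp (- (t * l0))"
      using dense[of p "1 - exp (- (t * l0))"] by auto
    then have "p' < 1"
      using exp_gt_zero[of "- (t * l0)"] by linarith
    have "- (t * l0) < ln (1 - p')"
      using p' \<open>p' < 1\<close> by (metis diff_gt_0_iff_gt exp_less_cancel_iff exp_ln less_diff_eq add.commute)
    then have less_t: "- ln (1 - p') / l0 < t"
      using l0 by (simp add: field_simps)
    \<comment> \<open>\<open>y\<close> is the value of ln (1 - q) that solves the first equation at
      \<alpha> = 0 and p'. It is negative because p' > p, so q = 1 - exp y is positive.\<close>
    define y where "y = ((2 * l1 + l0) * ln (1 - p') - 2 * l0 * ln p') / l0"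
    have "ln (1 - p') < ln (1 - p)" "ln p < ln p'"
      using p p' \<open>p' < 1\<close> by auto
    then have "(2 * l1 + l0) * ln (1 - p') < (2 * l1 + l0) * ln (1 - p)" "2 * l0 * ln p < 2 * l0 * ln p'"
      using l0 l1 by simp_all
    then have "y < 0"
      using eq l0 by (simp add: y_def divide_neg_pos)
    have "hausdorff_measure t (L_level l0 l1 0) = 0"
    proof (rule hausdorff_measure_L_level_zero)
      show "0 < p'" "p' < 1" "0 < 1 - exp y" "1 - exp y < 1"
        using p p' \<open>p' < 1\<close> \<open>y < 0\<close> by auto
      then show "dim_formula l0 0 p' (1 - exp y) < t"
        using less_t by (simp add: dim_formula_eq)
      show "0 * (l1 - l0) * (ln p' + ln (1 - (1 - exp y)) - ln (1 - p') - ln (1 - exp y)) +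
          l0 * (2 * ln p' + ln (1 - (1 - exp y)) - ln (1 - p')) - 2 * l1 * ln (1 - p') = 0"
        using l0 by (simp add: y_def field_simps)
    qed auto
    then show ?thesis .
  qed
  have lower: "hausdorff_measure t (L_set l0 l1) \<noteq> 0" if t: "0 \<le> t" "t < - ln (1 - p) / l0" for t
  proof -
    obtain \<kappa> where chain: "balanced_chain l0 l1 p 0 0 0 \<kappa> (- ln (1 - p) / l0)"
      using golden_mean_chain[OF assms] by blast
    show ?thesis
      unfolding L_set_def
      by (rule balanced_chain.hausdorff_measure_projection_nonzero[OF chain _ t typical_golden_mean]) auto
  qed
  have "hausdorff_measure t (L_set l0 l1) = 0" if "- ln (1 - p) / l0 < t" for t
    using hausdorff_measure_mono[OF sub, of t] upper[OF that] by simp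
  from nonneg this lower show "hausdorff_dim (L_set l0 l1) = - ln (1 - p) / l0"
    by (rule hausdorff_dim_eqI)
  have "hausdorff_measure t (L_level l0 l1 0) \<noteq> 0" if "0 \<le> t" "t < - ln (1 - p) / l0" for t
    using hausdorff_measure_mono[OF sub, of t] lower[OF that] by auto
  with nonneg upper show "hausdorff_dim (L_level l0 l1 0) = - ln (1 - p) / l0"
    by (rule hausdorff_dim_eqI)
qed

end

section \<open>The system of equations\<close>

definition second_root :: "real \<Rightarrow> real \<Rightarrow> real" where
  "second_root \<alpha> p = \<alpha> * (2 + p) / (2 * p + \<alpha>)"

lemma second_root_iff:
  assumes "0 < p" "0 < \<alpha>"
  shows "2 * p * q = \<alpha> * (2 + p - q) \<longleftrightarrow> q = second_root \<alpha> p"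
proof -
  have "2 * p + \<alpha> \<noteq> 0"
    using assms by simp
  then show ?thesis
    unfolding second_root_def by (simp add: nonzero_eq_divide_eq algebra_simps)
qed

lemma second_root_less_1:
  assumes "0 < p" "0 < \<alpha>" "\<alpha> < 1"
  shows "second_root \<alpha> p < 1 \<longleftrightarrow> \<alpha> / (2 - \<alpha>) < p"
  using assms by (simp add: second_root_def divide_less_eq algebra_simps)

lemma second_root_strict_antimono:
  assumes "0 < \<alpha>" "\<alpha> < 1" "0 < x" "x < y"
  shows "second_root \<alpha> y < second_root \<alpha> x"
proof -
  have "0 < \<alpha> * ((4 - \<alpha>) * (y - x))"
    using assms by (intro mult_pos_pos) auto
  then have "\<alpha> * (2 + y) * (2 * x + \<alpha>) < \<alpha> * (2 + x) * (2 * y + \<alpha>)"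
    by (simp add: algebra_simps)
  then show ?thesis
    unfolding second_root_def using assms by (subst pos_divide_less_eq) (auto simp: pos_less_divide_eq)
qed

text \<open>This compensates for the decrease of \<open>second_root\<close> in
  \<open>first_eq\<close> when l1 < l0, where ln q has a positive coefficient.\<close>

lemma mult_second_root_strict_mono:
  assumes "0 < \<alpha>" "\<alpha> < 1" "0 < x" "x < y"
  shows "x * second_root \<alpha> x < y * second_root \<alpha> y"
proof -
  have "0 < \<alpha> * ((y - x) * (2 * \<alpha> + 2 * (x * y) + \<alpha> * (x + y)))"
    using assms by (intro mult_pos_pos add_pos_pos) auto
  then have "x * (\<alpha> * (2 + x)) * (2 * y + \<alpha>) < y * (\<alpha> * (2 + y)) * (2 * x + \<alpha>)"
    by (simp add: algebra_simps)
  then have "x * (\<alpha> * (2 + x)) / (2 * x + \<alpha>) < y * (\<alpha> * (2 + y)) / (2 * y + \<alpha>)"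
    using assms by (subst pos_divide_less_eq) (auto simp: pos_less_divide_eq)
  then show ?thesis
    by (simp add: second_root_def)
qed

section \<open>The reduced equation in p\<close>

context ifs_pair
begin

definition first_eq :: "real \<Rightarrow> real \<Rightarrow> real \<Rightarrow> real" where
  "first_eq \<alpha> p q = \<alpha> * (l1 - l0) * (ln p + ln (1 - q) - ln (1 - p) - ln q)
       + l0 * (2 * ln p + ln (1 - q) - ln (1 - p)) - 2 * l1 * ln (1 - p)"

text \<open>One unknown is eliminated; the lower limit \<alpha> / (2 - \<alpha>) is the value of
  \<open>p\<close> at which the root q reaches 1.\<close>

lemma solves_system_second_root:
  assumes "0 < \<alpha>" "\<alpha> < 1"
  shows "solves_system l0 l1 \<alpha> p q \<longleftrightarrow>
    \<alpha> / (2 - \<alpha>) < p \<and> p < 1 \<and> q = second_root \<alpha> p \<and> first_eq \<alpha> p (second_root \<alpha> p) = 0"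
proof -
  have a: "0 < \<alpha> / (2 - \<alpha>)"
    using assms by simp
  show ?thesis
  proof (cases "0 < p")
    case True
    then have "0 < second_root \<alpha> p"
      using assms by (simp add: second_root_def)
    then show ?thesis
      unfolding solves_system_iff first_eq_def[symmetric] second_root_iff[OF True assms(1)]
      using True second_root_less_1[OF True assms] by auto
  next
    case False
    then show ?thesis
      using a by (auto simp: solves_system_iff)
  qed
qed

text \<open>As p grows, q decreases and pq increases. The terms in ln (1 - p) and ln (1 - q)
  therefore increase. The rest increases term by term if l0 \<le> l1, and otherwise is a positive
  combination of ln p and ln (pq).\<close>

lemma first_eq_strict_mono:
  assumes \<alpha>: "0 < \<alpha>" "\<alpha> < 1" and "\<alpha> / (2 - \<alpha>) < x" "x < y" "y < 1"
  shows "first_eq \<alpha> x (second_root \<alpha> x) < first_eq \<alpha> y (second_root \<alpha> y)"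
proof -
  define v w where "v = second_root \<alpha> x" and "w = second_root \<alpha> y"
  have "0 < \<alpha> / (2 - \<alpha>)"
    using \<alpha> by simp
  then have x: "0 < x"
    using assms by linarith
  have v: "0 < w" "w < v" "v < 1" "x * v < y * w"
    using \<alpha> assms x second_root_less_1[of x \<alpha>] second_root_strict_antimono[of \<alpha> x y]
      mult_second_root_strict_mono[of \<alpha> x y] by (auto simp: v_def w_def second_root_def)
  have ln: "ln x < ln y" "ln (1 - y) < ln (1 - x)" "ln w < ln v" "ln (1 - v) < ln (1 - w)"
    using assms x v by auto
  have "ln (x * v) < ln (y * w)"
    using v x assms by (intro ln_less_cancel_iff[THEN iffD2]) auto
  then have ln_mult: "ln x + ln v < ln y + ln w"
    using v x assms by (simp add: ln_mult)
  define K where "K = \<alpha> * l1 + (1 - \<alpha>) * l0"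
  have K: "0 < K"
    using \<alpha> l0 l1 by (simp add: K_def add_pos_pos)
  have "0 < (K + 2 * l1) * (ln (1 - x) - ln (1 - y))" "0 < K * (ln (1 - w) - ln (1 - v))"
    using K l1 ln by (auto intro!: mult_pos_pos)
  moreover have "0 \<le> (2 * l0 + \<alpha> * (l1 - l0)) * (ln y - ln x) - \<alpha> * (l1 - l0) * (ln w - ln v)"
  proof (cases "l0 \<le> l1")
    case True
    then have "0 \<le> (2 * l0 + \<alpha> * (l1 - l0)) * (ln y - ln x)" "0 \<le> \<alpha> * (l1 - l0) * (ln v - ln w)"
      using ln \<alpha> l0 by (auto intro!: mult_nonneg_nonneg add_nonneg_nonneg)
    then show ?thesis
      by (simp add: algebra_simps)
  next
    case False
    have "0 \<le> \<alpha> * (l0 - l1) * ((ln y + ln w) - (ln x + ln v))"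
      using False \<alpha> ln_mult by (intro mult_nonneg_nonneg) auto
    moreover have "0 \<le> 2 * ((1 - \<alpha>) * l0 + \<alpha> * l1) * (ln y - ln x)"
      using \<alpha> l0 l1 ln by (intro mult_nonneg_nonneg add_nonneg_nonneg) auto
    ultimately show ?thesis
      by (simp add: algebra_simps)
  qed
  ultimately have "first_eq \<alpha> x v < first_eq \<alpha> y w"
    unfolding first_eq_def K_def by (simp add: algebra_simps)
  then show ?thesis
    by (simp add: v_def w_def)
qed

lemma first_eq_continuous:
  assumes "0 < \<alpha>" "\<alpha> < 1" "\<alpha> / (2 - \<alpha>) < x" "y < 1"
  shows "continuous_on {x..y} (\<lambda>p. first_eq \<alpha> p (second_root \<alpha> p))"
proof -
  have "0 < \<alpha> / (2 - \<alpha>)"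
    using assms by simp
  then have "0 < x"
    using assms by linarith
  have "0 < second_root \<alpha> p" "second_root \<alpha> p < 1" if "p \<in> {x..y}" for p
    using that assms \<open>0 < x\<close> second_root_less_1[of p \<alpha>] by (auto simp: second_root_def)
  moreover have "continuous_on {x..y} (second_root \<alpha>)"
    unfolding second_root_def using assms \<open>0 < x\<close> by (intro continuous_intros) auto
  ultimately show ?thesis
    unfolding first_eq_def using assms \<open>0 < x\<close> by (intro continuous_intros) force+
qed

text \<open>There q tends to 1, so K ln (1 - q) tends to minus infinity while the other terms
  converge.\<close>

lemma first_eq_at_left_end:
  assumes \<alpha>: "0 < \<alpha>" "\<alpha> < 1"
  shows "filterlim (\<lambda>p. first_eq \<alpha> p (second_root \<alpha> p)) at_bot (at_right (\<alpha> / (2 - \<alpha>)))"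
proof -
  define a where "a = \<alpha> / (2 - \<alpha>)"
  have a: "0 < a" "a < 1"
    using \<alpha> by (auto simp: a_def)
  have root_a: "second_root \<alpha> a = 1"
    using \<alpha> a by (simp add: second_root_def a_def field_simps)
  define K where "K = \<alpha> * l1 + (1 - \<alpha>) * l0"
  have K: "0 < K"
    using \<alpha> l0 l1 by (simp add: K_def add_pos_pos)
  have root: "(second_root \<alpha> \<longlongrightarrow> 1) (at_right a)"
    unfolding root_a[symmetric] second_root_def using a \<alpha> by (intro tendsto_intros) auto
  have root_less: "second_root \<alpha> y < 1" if "a < y" for y
  proof -
    have "0 < y"
      using that a by linarith
    then show ?thesis
      using that \<alpha> second_root_less_1[of y \<alpha>] by (simp add: a_def)
  qed
  have "((\<lambda>p. 1 - second_root \<alpha> p) \<longlongrightarrow> 1 - 1) (at_right a)"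
    by (intro tendsto_intros root)
  moreover have "\<forall>\<^sub>F p in at_right a. 1 - second_root \<alpha> p \<in> {0<..} \<and> 1 - second_root \<alpha> p \<noteq> 0"
    unfolding eventually_at_right_field
    using a root_less by (intro exI[of _ 1]) force
  ultimately have "filterlim (\<lambda>p. 1 - second_root \<alpha> p) (at_right 0) (at_right a)"
    by (simp add: filterlim_at)
  then have "filterlim (\<lambda>p. ln (1 - second_root \<alpha> p)) at_bot (at_right a)"
    by (rule filterlim_compose[OF ln_at_0])
  then have "filterlim (\<lambda>p. K * ln (1 - second_root \<alpha> p)) at_bot (at_right a)"
    using K by (intro filterlim_tendsto_pos_mult_at_bot[OF tendsto_const])
  moreover have "((\<lambda>p. (2 * l0 + \<alpha> * (l1 - l0)) * ln p - (K + 2 * l1) * ln (1 - p)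
      - \<alpha> * (l1 - l0) * ln (second_root \<alpha> p)) \<longlongrightarrow>
      (2 * l0 + \<alpha> * (l1 - l0)) * ln a - (K + 2 * l1) * ln (1 - a) - \<alpha> * (l1 - l0) * ln 1) (at_right a)"
    using a root by (intro tendsto_intros) auto
  ultimately have "filterlim (\<lambda>p. ((2 * l0 + \<alpha> * (l1 - l0)) * ln p - (K + 2 * l1) * ln (1 - p)
      - \<alpha> * (l1 - l0) * ln (second_root \<alpha> p)) + K * ln (1 - second_root \<alpha> p)) at_bot (at_right a)"
    by (simp only: filterlim_tendsto_add_at_bot_iff)
  then show ?thesis
    unfolding a_def[symmetric] by (rule back_subst[of "\<lambda>f. filterlim f at_bot (at_right a)"])
      (auto simp: first_eq_def K_def algebra_simps)
qed

text \<open>Here q stays away from 0 and 1, and only - (K + 2 * l1) * ln (1 - p) diverges.\<close>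

lemma first_eq_at_right_end:
  assumes \<alpha>: "0 < \<alpha>" "\<alpha> < 1"
  shows "filterlim (\<lambda>p. first_eq \<alpha> p (second_root \<alpha> p)) at_top (at_left 1)"
proof -
  define K where "K = \<alpha> * l1 + (1 - \<alpha>) * l0"
  have K: "0 < K + 2 * l1"
    using \<alpha> l0 l1 by (simp add: K_def add_pos_pos)
  have root: "(second_root \<alpha> \<longlongrightarrow> second_root \<alpha> 1) (at_left 1)"
    unfolding second_root_def using \<alpha> by (intro tendsto_intros) auto
  have root_1: "0 < second_root \<alpha> 1" "second_root \<alpha> 1 < 1"
    using \<alpha> by (auto simp: second_root_def)
  have "filterlim (\<lambda>p :: real. - ln (1 - p)) at_top (at_left 1)"
    by real_asymp
  then have "filterlim (\<lambda>p. (K + 2 * l1) * - ln (1 - p)) at_top (at_left 1)"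
    using K by (intro filterlim_tendsto_pos_mult_at_top[OF tendsto_const])
  moreover have "((\<lambda>p. (2 * l0 + \<alpha> * (l1 - l0)) * ln p + K * ln (1 - second_root \<alpha> p)
      - \<alpha> * (l1 - l0) * ln (second_root \<alpha> p)) \<longlongrightarrow>
      (2 * l0 + \<alpha> * (l1 - l0)) * ln 1 + K * ln (1 - second_root \<alpha> 1)
      - \<alpha> * (l1 - l0) * ln (second_root \<alpha> 1)) (at_left 1)"
    using root root_1 by (intro tendsto_intros) auto
  ultimately have "filterlim (\<lambda>p. ((2 * l0 + \<alpha> * (l1 - l0)) * ln p + K * ln (1 - second_root \<alpha> p)
      - \<alpha> * (l1 - l0) * ln (second_root \<alpha> p)) + (K + 2 * l1) * - ln (1 - p)) at_top (at_left 1)"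
    by (rule filterlim_tendsto_add_at_top[rotated])
  then show ?thesis
    by (rule back_subst[of "\<lambda>f. filterlim f at_top (at_left 1)"])
      (auto simp: first_eq_def K_def algebra_simps)
qed

lemma solves_system_ex1:
  assumes \<alpha>: "0 < \<alpha>" "\<alpha> < 1"
  shows "\<exists>!(p, q). solves_system l0 l1 \<alpha> p q"
proof -
  define a where "a = \<alpha> / (2 - \<alpha>)"
  define F where "F = (\<lambda>p. first_eq \<alpha> p (second_root \<alpha> p))"
  have "a < 1"
    using \<alpha> by (simp add: a_def)
  \<comment> \<open>The midpoint separates the two sample points, so x < y for the intermediate
    value theorem.\<close>
  define m where "m = (a + 1) / 2"
  have m: "a < m" "m < 1"
    using \<open>a < 1\<close> by (auto simp: m_def)
  have "\<forall>\<^sub>F p in at_right a. F p \<le> 0"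
    using first_eq_at_left_end[OF \<alpha>] unfolding F_def a_def filterlim_at_bot by blast
  moreover have "\<forall>\<^sub>F p in at_right a. p \<in> {a<..<m}"
    using m by (intro eventually_at_right_real)
  ultimately have "\<forall>\<^sub>F p in at_right a. F p \<le> 0 \<and> p \<in> {a<..<m}"
    by (rule eventually_conj)
  then obtain x where x: "F x \<le> 0" "a < x" "x < m"
    using eventually_happens'[OF trivial_limit_at_right_real] by fastforce
  have "\<forall>\<^sub>F p in at_left 1. 0 \<le> F p"
    using first_eq_at_right_end[OF \<alpha>] unfolding F_def filterlim_at_top by blast
  moreover have "\<forall>\<^sub>F p in at_left 1. p \<in> {m<..<1}"
    using m by (intro eventually_at_left_real)
  ultimately have "\<forall>\<^sub>F p in at_left 1. 0 \<le> F p \<and> p \<in> {m<..<1}"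
    by (rule eventually_conj)
  then obtain y where y: "0 \<le> F y" "m < y" "y < 1"
    using eventually_happens'[OF trivial_limit_at_left_real] by fastforce
  obtain p where p: "x \<le> p" "p \<le> y" "F p = 0"
    using IVT'[of F x 0 y] first_eq_continuous[OF \<alpha>, of x y] x y unfolding F_def a_def by auto
  show ?thesis
  proof (rule ex1I[of _ "(p, second_root \<alpha> p)"])
    show "case (p, second_root \<alpha> p) of (p, q) \<Rightarrow> solves_system l0 l1 \<alpha> p q"
      using p x y by (simp add: solves_system_second_root[OF \<alpha>] a_def F_def)
    fix z assume "case z of (p, q) \<Rightarrow> solves_system l0 l1 \<alpha> p q"
    then obtain p' q' where z: "z = (p', q')" "a < p'" "p' < 1" "q' = second_root \<alpha> p'" "F p' = 0"
      by (cases z) (auto simp: solves_system_second_root[OF \<alpha>] a_def F_def)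
    have "p' = p"
      using first_eq_strict_mono[OF \<alpha>, of p p'] first_eq_strict_mono[OF \<alpha>, of p' p] z p x y
      unfolding F_def a_def by (cases p p' rule: linorder_cases) auto
    then show "z = (p, second_root \<alpha> p)"
      using z by simp
  qed
qed

section \<open>The limit at level 1\<close>

lemma solution_tendsto_1:
  assumes sol: "\<And>\<alpha>. 0 < \<alpha> \<Longrightarrow> \<alpha> < 1 \<Longrightarrow> solves_system l0 l1 \<alpha> (P \<alpha>) (Q \<alpha>)"
  shows "(P \<longlongrightarrow> 1) (at_left 1)" "(Q \<longlongrightarrow> 1) (at_left 1)"
proof -
  have ev: "\<forall>\<^sub>F \<alpha> in at_left 1. \<alpha> / (2 - \<alpha>) < P \<alpha> \<and> P \<alpha> < 1 \<and> Q \<alpha> = second_root \<alpha> (P \<alpha>)"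
    unfolding eventually_at_left_field using sol
    by (intro exI[of _ 0]) (auto simp: solves_system_second_root)
  \<comment> \<open>The lower limit for \<open>p\<close> tends to 1 and squeezes \<open>P\<close>;
    \<open>Q\<close> follows by continuity of \<open>second_root\<close>.\<close>
  have low: "((\<lambda>\<alpha>. \<alpha> / (2 - \<alpha>)) \<longlongrightarrow> 1) (at_left (1 :: real))"
    by real_asymp
  show P: "(P \<longlongrightarrow> 1) (at_left 1)"
  proof (rule tendsto_sandwich[OF _ _ low tendsto_const])
    show "\<forall>\<^sub>F \<alpha> in at_left 1. \<alpha> / (2 - \<alpha>) \<le> P \<alpha>" "\<forall>\<^sub>F \<alpha> in at_left 1. P \<alpha> \<le> 1"
      using ev by (eventually_elim, simp)+
  qed
  have "((\<lambda>\<alpha>. second_root \<alpha> (P \<alpha>)) \<longlongrightarrow> 1 * (2 + 1) / (2 * 1 + 1)) (at_left 1)"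
    unfolding second_root_def by (intro tendsto_intros P) auto
  moreover have "\<forall>\<^sub>F \<alpha> in at_left 1. second_root \<alpha> (P \<alpha>) = Q \<alpha>"
    using ev by eventually_elim simp
  ultimately have "(Q \<longlongrightarrow> 1 * (2 + 1) / (2 * 1 + 1)) (at_left 1)"
    by (rule Lim_transform_eventually)
  then show "(Q \<longlongrightarrow> 1) (at_left 1)"
    by simp
qed

text \<open>In the form with \<open>l1\<close> the critical term is (1 - \<alpha>) M. The sign of
  the log cross ratio gives 1 - q \<le> 2 (1 - p), the second equation then gives 1 - \<alpha> \<le>
  7 (1 - p), and nonnegativity of the dimension gives M \<le> -4 ln (1 - p); hence 28 = 7 *
  4.\<close>

lemma dim_formula_near_1:
  assumes \<alpha>: "1/2 \<le> \<alpha>" "\<alpha> < 1" and sol: "solves_system l0 l1 \<alpha> p q" and "1/2 \<le> p"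
    and L: "ln p + ln (1 - q) - ln (1 - p) - ln q \<le> 0"
  shows "2 * l1 * dim_formula l0 \<alpha> p q \<le> 28 * (- ((1 - p) * ln (1 - p))) - ln p - ln q"
proof -
  have pq: "0 < p" "p < 1" "0 < q" "q < 1"
    and eq: "\<alpha> * (l1 - l0) * (ln p + ln (1 - q) - ln (1 - p) - ln q)
       + l0 * (2 * ln p + ln (1 - q) - ln (1 - p)) - 2 * l1 * ln (1 - p) = 0"
    and eq2: "2 * p * q = \<alpha> * (2 + p - q)"
    using sol by (auto simp: solves_system_iff)
  define M where "M = - (ln p + ln (1 - q) - ln (1 - p) - ln q)"
  have "M \<ge> 0"
    using L by (simp add: M_def)
  have "ln (p * (1 - q)) \<le> ln ((1 - p) * q)"
    using L pq by (simp add: ln_mult)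
  then have "p * (1 - q) \<le> (1 - p) * q"
    using pq by (subst (asm) ln_le_cancel_iff) auto
  moreover have "1/2 * (1 - q) \<le> p * (1 - q)" "(1 - p) * q \<le> (1 - p) * 1"
    using pq \<open>1/2 \<le> p\<close> by (intro mult_right_mono mult_left_mono; simp)+
  ultimately have "1/2 * (1 - q) \<le> (1 - p) * 1"
    by (meson order_trans)
  then have q_le: "1 - q \<le> 2 * (1 - p)"
    by simp
  have prod_nonneg: "0 \<le> (1 - p) * (1 - q)"
    using pq by simp
  have "(1 - \<alpha>) * 1 \<le> (1 - \<alpha>) * (2 + p - q)"
    using pq \<alpha> by (intro mult_left_mono) auto
  also have "\<dots> = (1 - p) + 3 * (1 - q) - 2 * ((1 - p) * (1 - q))"
    using eq2 by (simp add: algebra_simps)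
  also have "\<dots> \<le> (1 - p) + 3 * (1 - q)"
    using prod_nonneg by simp
  also have "\<dots> \<le> 7 * (1 - p)"
    using q_le by simp
  finally have \<alpha>_le: "1 - \<alpha> \<le> 7 * (1 - p)"
    by simp
  have "0 \<le> dim_formula l0 \<alpha> p q * (2 * l0)"
    using dim_formula_nonneg[OF pq _ _ eq] \<alpha> l0 by simp
  also have "\<dots> = \<alpha> * (- M) - 2 * ln (1 - p)"
    using l0 by (simp add: dim_formula_eq pq M_def)
  finally have "\<alpha> * M \<le> 2 * - ln (1 - p)"
    by simp
  moreover have "1/2 * M \<le> \<alpha> * M"
    using \<alpha> \<open>M \<ge> 0\<close> by (intro mult_right_mono)
  ultimately have M_le: "M \<le> 4 * - ln (1 - p)"
    by simp
  have "(1 - \<alpha>) * M \<le> (7 * (1 - p)) * (4 * - ln (1 - p))"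
    using \<alpha>_le M_le \<open>M \<ge> 0\<close> pq by (intro mult_mono) auto
  moreover have "(7 * (1 - p)) * (4 * - ln (1 - p)) = 28 * (- ((1 - p) * ln (1 - p)))"
    by (simp add: algebra_simps)
  moreover have "2 * l1 * dim_formula l0 \<alpha> p q = (1 - \<alpha>) * M - (ln p + ln q)"
    unfolding dim_formula_l1[OF pq eq] M_def by (simp only: mult_minus_left mult_minus_right)
  ultimately show ?thesis
    by linarith
qed

text \<open>With L the log cross ratio, the first equation reads (\<alpha> l1 + (1 - \<alpha>) l0) L
  + l0 (ln p + ln q) = 2 l1 ln (1 - p). For p near 1 the right side is very negative, which forces
  the sign of L.\<close>

lemma solution_ratio_neg:
  assumes \<alpha>: "0 < \<alpha>" "\<alpha> < 1" and sol: "solves_system l0 l1 \<alpha> p q"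
    and large: "2 * l1 * ln (1 - p) < l0 * (ln p + ln q)"
  shows "ln p + ln (1 - q) - ln (1 - p) - ln q \<le> 0"
proof (rule ccontr)
  define L where "L = ln p + ln (1 - q) - ln (1 - p) - ln q"
  assume "\<not> ?thesis"
  then have "0 \<le> (\<alpha> * l1 + (1 - \<alpha>) * l0) * L"
    using \<alpha> l0 l1 by (intro mult_nonneg_nonneg add_nonneg_nonneg) (auto simp: L_def)
  moreover have "(\<alpha> * l1 + (1 - \<alpha>) * l0) * L + l0 * (ln p + ln q) - 2 * l1 * ln (1 - p) = 0"
    using sol unfolding solves_system_iff L_def by (simp add: algebra_simps)
  ultimately show False
    using large by linarith
qed

text \<open>For \<alpha> near 1 the log cross ratio is at most 0, so the chain for \<alpha> bounds
  the dimension at level 1 by its own dimension value. These values tend to 0, hence so does the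
  formula, and the dimension at level 1 is 0.\<close>

lemma dim_formula_tendsto_L_level_1:
  assumes sol: "\<And>\<alpha>. 0 < \<alpha> \<Longrightarrow> \<alpha> < 1 \<Longrightarrow> solves_system l0 l1 \<alpha> (P \<alpha>) (Q \<alpha>)"
  shows "((\<lambda>\<alpha>. dim_formula l0 \<alpha> (P \<alpha>) (Q \<alpha>)) \<longlongrightarrow> hausdorff_dim (L_level l0 l1 1)) (at_left 1)"
proof -
  let ?s = "\<lambda>\<alpha>. dim_formula l0 \<alpha> (P \<alpha>) (Q \<alpha>)"
  let ?L = "\<lambda>\<alpha>. ln (P \<alpha>) + ln (1 - Q \<alpha>) - ln (1 - P \<alpha>) - ln (Q \<alpha>)"
  note lim = solution_tendsto_1[OF sol]
  have near: "\<forall>\<^sub>F \<alpha> in at_left 1. 1/2 \<le> \<alpha> \<and> \<alpha> < (1 :: real)"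
    unfolding eventually_at_left_field by (intro exI[of _ "1/2"]) auto
  have "\<forall>\<^sub>F \<alpha> in at_left 1. P \<alpha> \<in> {..<1}"
    using near by eventually_elim (use sol in \<open>auto simp: solves_system_iff\<close>)
  then have P_left: "filterlim P (at_left 1) (at_left 1)"
    using lim(1) unfolding filterlim_at by (auto simp: eventually_conj_iff elim: eventually_mono)
  have "filterlim (\<lambda>p. 2 * l1 * ln (1 - p)) at_bot (at_left (1 :: real))"
    using l1 by real_asymp
  then have "filterlim (\<lambda>\<alpha>. 2 * l1 * ln (1 - P \<alpha>)) at_bot (at_left 1)"
    using P_left by (rule filterlim_compose)
  then have "\<forall>\<^sub>F \<alpha> in at_left 1. 2 * l1 * ln (1 - P \<alpha>) \<le> -1"
    unfolding filterlim_at_bot by blast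
  moreover have "((\<lambda>\<alpha>. l0 * (ln (P \<alpha>) + ln (Q \<alpha>))) \<longlongrightarrow> l0 * (ln 1 + ln 1)) (at_left 1)"
    by (intro tendsto_intros lim) auto
  then have "\<forall>\<^sub>F \<alpha> in at_left 1. -1 < l0 * (ln (P \<alpha>) + ln (Q \<alpha>))"
    by (rule order_tendstoD) simp
  ultimately have ratio: "\<forall>\<^sub>F \<alpha> in at_left 1. ?L \<alpha> \<le> 0"
    using near
  proof eventually_elim
    case (elim \<alpha>)
    then show ?case
      by (intro solution_ratio_neg[of \<alpha>] sol) auto
  qed
  have "\<forall>\<^sub>F \<alpha> in at_left 1. 1/2 < P \<alpha>"
    using order_tendstoD(1)[OF lim(1), of "1/2"] by simp
  then have upper: "\<forall>\<^sub>F \<alpha> in at_left 1. 2 * l1 * ?s \<alpha> \<le>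
      28 * (- ((1 - P \<alpha>) * ln (1 - P \<alpha>))) - ln (P \<alpha>) - ln (Q \<alpha>)"
    using near ratio
  proof eventually_elim
    case (elim \<alpha>)
    then show ?case
      by (intro dim_formula_near_1 sol) auto
  qed
  have lower: "\<forall>\<^sub>F \<alpha> in at_left 1. 0 \<le> 2 * l1 * ?s \<alpha>"
    using near
  proof eventually_elim
    case (elim \<alpha>)
    then have "solves_system l0 l1 \<alpha> (P \<alpha>) (Q \<alpha>)"
      by (intro sol) auto
    then have "0 \<le> ?s \<alpha>"
      using elim by (intro dim_formula_nonneg) (auto simp: solves_system_iff)
    then show ?case
      using l1 by simp
  qed
  have "((\<lambda>p :: real. - ((1 - p) * ln (1 - p))) \<longlongrightarrow> 0) (at_left 1)"
    by real_asymp
  then have "((\<lambda>\<alpha>. - ((1 - P \<alpha>) * ln (1 - P \<alpha>))) \<longlongrightarrow> 0) (at_left 1)"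
    using P_left by (rule filterlim_compose)
  then have "((\<lambda>\<alpha>. 28 * (- ((1 - P \<alpha>) * ln (1 - P \<alpha>))) - ln (P \<alpha>) - ln (Q \<alpha>)) \<longlongrightarrow>
      28 * 0 - ln 1 - ln 1) (at_left 1)"
    by (intro tendsto_intros lim) auto
  then have "((\<lambda>\<alpha>. 2 * l1 * ?s \<alpha>) \<longlongrightarrow> 0) (at_left 1)"
    by (rule tendsto_sandwich[OF lower upper tendsto_const, OF tendsto_eq_rhs]) simp
  then have "((\<lambda>\<alpha>. inverse (2 * l1) * (2 * l1 * ?s \<alpha>)) \<longlongrightarrow> inverse (2 * l1) * 0) (at_left 1)"
    by (intro tendsto_intros)
  then have s_lim: "(?s \<longlongrightarrow> 0) (at_left 1)"
    using l1 by (simp add: field_simps)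
  have dim: "\<forall>\<^sub>F \<alpha> in at_left 1. hausdorff_dim (L_level l0 l1 1) \<in> {0..?s \<alpha>}"
    using near ratio
  proof eventually_elim
    case (elim \<alpha>)
    then have "solves_system l0 l1 \<alpha> (P \<alpha>) (Q \<alpha>)"
      by (intro sol) auto
    then have *: "0 < P \<alpha>" "P \<alpha> < 1" "0 < Q \<alpha>" "Q \<alpha> < 1" "\<alpha> * (l1 - l0) * ?L \<alpha>
       + l0 * (2 * ln (P \<alpha>) + ln (1 - Q \<alpha>) - ln (1 - P \<alpha>)) - 2 * l1 * ln (1 - P \<alpha>) = 0"
      by (auto simp: solves_system_iff)
    have "0 \<le> - ?L \<alpha> * (1 - \<alpha>)"
      using elim by (intro mult_nonneg_nonneg) auto
    then show ?case
      using * elim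
      by (intro hausdorff_dim_bounds dim_formula_nonneg hausdorff_measure_L_level_zero[of "P \<alpha>" "Q \<alpha>" \<alpha>]) auto
  qed
  have "hausdorff_dim (L_level l0 l1 1) \<le> 0"
  proof (rule tendsto_lowerbound)
    show "\<forall>\<^sub>F \<alpha> in at_left 1. hausdorff_dim (L_level l0 l1 1) \<le> ?s \<alpha>"
      using dim by eventually_elim simp
  qed (use s_lim in simp_all)
  moreover have "0 \<le> hausdorff_dim (L_level l0 l1 1)"
    using eventually_happens'[OF trivial_limit_at_left_real dim] by auto
  ultimately show ?thesis
    using s_lim by simp
qed

end

text \<open>Right side minus left side is (1 - p) q + (1 - q) p + 2 (1 - q), a sum of nonnegative
  terms on the square.\<close>

lemma second_equation_at_1:
  fixes p q :: real
  assumes "p \<in> {0..1}" "q \<in> {0..1}"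
  shows "2 * p * q = 1 * (2 + p - q) \<longleftrightarrow> p = 1 \<and> q = 1"
proof
  assume "2 * p * q = 1 * (2 + p - q)"
  then have "(1 - p) * q + (1 - q) * p + 2 * (1 - q) = 0"
    by (simp add: algebra_simps)
  moreover have "0 \<le> (1 - p) * q" "0 \<le> (1 - q) * p"
    using assms by auto
  ultimately have "2 * (1 - q) \<le> 0"
    by linarith
  then have "q = 1"
    using assms by simp
  then show "p = 1 \<and> q = 1"
    using \<open>2 * p * q = 1 * (2 + p - q)\<close> by simp
qed auto

theorem theorem1p3:
  fixes l\<^sub>0 l\<^sub>1 :: real
  assumes "l\<^sub>0 > 0" and "l\<^sub>1 > 0" and "exp (- l\<^sub>0) + exp (- l\<^sub>1) \<le> 1"
  shows
    "(\<exists>!p. p \<in> {0..1} \<and> p powr (2 * l\<^sub>0) = (1 - p) powr (2 * l\<^sub>1 + l\<^sub>0)) \<and>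
     (\<forall>p\<in>{0..1}. p powr (2 * l\<^sub>0) = (1 - p) powr (2 * l\<^sub>1 + l\<^sub>0) \<longrightarrow>
        hausdorff_dim (L_set l\<^sub>0 l\<^sub>1) = - ln (1 - p) / l\<^sub>0 \<and>
        hausdorff_dim (L_level l\<^sub>0 l\<^sub>1 0) = - ln (1 - p) / l\<^sub>0) \<and>
     (\<forall>\<alpha>\<in>{0<..<1}.
        (\<exists>!(p, q). solves_system l\<^sub>0 l\<^sub>1 \<alpha> p q) \<and>
        (\<forall>p q. solves_system l\<^sub>0 l\<^sub>1 \<alpha> p q \<longrightarrow>
           hausdorff_dim (L_level l\<^sub>0 l\<^sub>1 \<alpha>) = dim_formula l\<^sub>0 \<alpha> p q)) \<and>
     (\<forall>p\<in>{0..1::real}. \<forall>q\<in>{0..1::real}. 2 * p * q = 1 * (2 + p - q) \<longleftrightarrow> p = 1 \<and> q = 1) \<and>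
     (\<forall>P Q. (\<forall>\<alpha>\<in>{0<..<1}. solves_system l\<^sub>0 l\<^sub>1 \<alpha> (P \<alpha>) (Q \<alpha>)) \<longrightarrow>
        (P \<longlongrightarrow> 1) (at_left 1) \<and> (Q \<longlongrightarrow> 1) (at_left 1) \<and>
        ((\<lambda>\<alpha>. dim_formula l\<^sub>0 \<alpha> (P \<alpha>) (Q \<alpha>)) \<longlongrightarrow> hausdorff_dim (L_level l\<^sub>0 l\<^sub>1 1)) (at_left 1))"
proof -
  interpret ifs_pair l\<^sub>0 l\<^sub>1
    using assms by unfold_locales
  show ?thesis
  proof (intro conjI ballI allI impI)
    fix p assume p: "p \<in> {0..1}" "p powr (2 * l\<^sub>0) = (1 - p) powr (2 * l\<^sub>1 + l\<^sub>0)"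
    note log = golden_mean_equation_log[OF p]
    show "hausdorff_dim (L_set l\<^sub>0 l\<^sub>1) = - ln (1 - p) / l\<^sub>0"
      "hausdorff_dim (L_level l\<^sub>0 l\<^sub>1 0) = - ln (1 - p) / l\<^sub>0"
      using hausdorff_dim_golden_mean[OF log] by auto
  next
    fix P Q assume "\<forall>\<alpha>\<in>{0<..<1}. solves_system l\<^sub>0 l\<^sub>1 \<alpha> (P \<alpha>) (Q \<alpha>)"
    then have sol: "\<And>\<alpha>. 0 < \<alpha> \<Longrightarrow> \<alpha> < 1 \<Longrightarrow> solves_system l\<^sub>0 l\<^sub>1 \<alpha> (P \<alpha>) (Q \<alpha>)"
      by simp
    show "(P \<longlongrightarrow> 1) (at_left 1)" "(Q \<longlongrightarrow> 1) (at_left 1)"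
      "((\<lambda>\<alpha>. dim_formula l\<^sub>0 \<alpha> (P \<alpha>) (Q \<alpha>)) \<longlongrightarrow> hausdorff_dim (L_level l\<^sub>0 l\<^sub>1 1)) (at_left 1)"
      using solution_tendsto_1[OF sol] dim_formula_tendsto_L_level_1[OF sol] by auto
  qed (use golden_mean_equation_ex1 solves_system_ex1 hausdorff_dim_L_level second_equation_at_1 in auto)
qed

end
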